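(* Let $X$ be a set, let $z\in X$ and $X^-=X\smallsetminus\{z\}$. Let $n\in\mathbb{N}$ and let $\sum_{r=0}^{n-1}t^r=\prod_{j\in\mathcal{J}}f_j$, where the $f_j$ are irreducible in $\mathbb{Z}[t]$, and let $M_j=\mathrm{Aff}\big(\bigoplus_{x\in X^-}\mathbb{Z}[t]/(f_j),\,t\big)$ for each $j\in\mathcal{J}$. Then each free $n$-symmetric medial quandle over $X$ is isomorphic to the subquandle of $\prod_{j\in\mathcal{J}}M_j$ generated by $\{(e_i)_{j\in\mathcal{J}};\ i\in X\}$.
   Context: A quandle is a set $Q$ with a binary operation $\ast$ such that, for all $x,y,w\in Q$: $x\ast(y\ast w)=(x\ast y)\ast(x\ast w)$; the equation $x\ast u=y$ has a unique solution $u\in Q$, denoted $x\backslash y$; and $x\ast x=x$. It is medial if $(x\ast y)\ast(u\ast v)=(x\ast u)\ast(y\ast v)$ for all $x,y,u,v\in Q$. It is $n$-symmetric if $x\ast(x\ast\cdots\ast(x\ast y)\cdots)=y$ ($n$ left multiplications by $x$) for all $x,y\in Q$. With the operations $\ast,\backslash$ the $n$-symmetric medial quandles form a variety; a free $n$-symmetric medial quandle over $X$ is a free algebra over $X$ in it. Generation of subquandles is with respect to both $\ast$ and $\backslash$; products of quandles are taken componentwise. For a module $A$ over a commutative ring and a ring element $t$ acting invertibly on $A$, the affine quandle $\mathrm{Aff}(A,t)$ is the set $A$ with the operation $a\ast b=(1-t)\cdot a+t\cdot b$. For each $j$, $e_i$ ($i\in X^-$) denotes the $i$-th element of the standard free basis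 of the $\mathbb{Z}[t]/(f_j)$-module $\bigoplus_{x\in X^-}\mathbb{Z}[t]/(f_j)$, and $e_z=0$; $(e_i)_{j\in\mathcal{J}}$ is the element of the product all of whose components are $e_i$.
   Formalization: The case n = 1 is excluded: there the sum is 1, so the product over J is empty and the subquandle has one point, while the free 1-symmetric medial quandle over X is X with x*y = y, so the claim fails once X has two elements. *)

theory Defs
  imports "HOL-Algebra.Algebraic_Closure_Type"
begin

record 'a quandle_struct = "'a partial_object" +
  qmult :: "'a \<Rightarrow> 'a \<Rightarrow> 'a" (infixl \<open>\<star>\<index>\<close> 70)

definition left_div :: "('a, 'm) quandle_struct_scheme \<Rightarrow> 'a \<Rightarrow> 'a \<Rightarrow> 'a"
  where "left_div Q x y = (THE u. u \<in> carrier Q \<and> x \<star>\<^bsub>Q\<^esub> u = y)"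

locale quandle =
  fixes Q (structure)
  assumes closed [intro, simp]: "\<lbrakk>x \<in> carrier Q; y \<in> carrier Q\<rbrakk> \<Longrightarrow> x \<star> y \<in> carrier Q"
    and left_distrib: "\<lbrakk>x \<in> carrier Q; y \<in> carrier Q; w \<in> carrier Q\<rbrakk>
      \<Longrightarrow> x \<star> (y \<star> w) = (x \<star> y) \<star> (x \<star> w)"
    and left_quasi: "\<lbrakk>x \<in> carrier Q; y \<in> carrier Q\<rbrakk> \<Longrightarrow> \<exists>!u. u \<in> carrier Q \<and> x \<star> u = y"
    and idem: "x \<in> carrier Q \<Longrightarrow> x \<star> x = x"

locale nsym_medial_quandle = quandle Q for n :: nat and Q (structure) +
  assumes medial: "\<lbrakk>x \<in> carrier Q; y \<in> carrier Q; u \<in> carrier Q; v \<in> carrier Q\<rbrakk>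
      \<Longrightarrow> (x \<star> y) \<star> (u \<star> v) = (x \<star> u) \<star> (y \<star> v)"
    and n_symmetric: "\<lbrakk>x \<in> carrier Q; y \<in> carrier Q\<rbrakk> \<Longrightarrow> ((\<lambda>u. x \<star> u) ^^ n) y = y"

definition quandle_hom ::
  "('a, 'm) quandle_struct_scheme \<Rightarrow> ('b, 'k) quandle_struct_scheme \<Rightarrow> ('a \<Rightarrow> 'b) set"
  where "quandle_hom Q R = {h \<in> carrier Q \<rightarrow> carrier R.
    \<forall>x\<in>carrier Q. \<forall>y\<in>carrier Q.
      h (x \<star>\<^bsub>Q\<^esub> y) = h x \<star>\<^bsub>R\<^esub> h y \<and> h (left_div Q x y) = left_div R (h x) (h y)}"

definition quandle_iso ::
  "('a, 'm) quandle_struct_scheme \<Rightarrow> ('b, 'k) quandle_struct_scheme \<Rightarrow> bool"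
  where "quandle_iso Q R \<longleftrightarrow> (\<exists>h \<in> quandle_hom Q R. bij_betw h (carrier Q) (carrier R))"

inductive_set quandle_span :: "('a, 'm) quandle_struct_scheme \<Rightarrow> 'a set \<Rightarrow> 'a set"
  for Q and S where
  base: "x \<in> S \<Longrightarrow> x \<in> quandle_span Q S"
| mult: "\<lbrakk>x \<in> quandle_span Q S; y \<in> quandle_span Q S\<rbrakk> \<Longrightarrow> x \<star>\<^bsub>Q\<^esub> y \<in> quandle_span Q S"
| ldiv: "\<lbrakk>x \<in> quandle_span Q S; y \<in> quandle_span Q S\<rbrakk> \<Longrightarrow> left_div Q x y \<in> quandle_span Q S"

definition subquandle_generated ::
  "('a, 'm) quandle_struct_scheme \<Rightarrow> 'a set \<Rightarrow> ('a, 'm) quandle_struct_scheme"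
  where "subquandle_generated Q S = Q\<lparr>carrier := quandle_span Q S\<rparr>"

definition quandle_prod ::
  "'j set \<Rightarrow> ('j \<Rightarrow> ('a, 'm) quandle_struct_scheme) \<Rightarrow> ('j \<Rightarrow> 'a) quandle_struct"
  where "quandle_prod J M =
    \<lparr>carrier = (\<Pi>\<^sub>E j\<in>J. carrier (M j)), qmult = (\<lambda>a b. \<lambda>j\<in>J. a j \<star>\<^bsub>M j\<^esub> b j)\<rparr>"


datatype 'x qterm = Var 'x | Mult "'x qterm" "'x qterm" | LDiv "'x qterm" "'x qterm"

text \<open>
  A free algebra over \<open>Xs\<close> is an algebra of the variety that is generated by the image of \<open>Xs\<close> and
  has the universal mapping property. A definition in HOL cannot quantify over all types, so the
  test algebras \<open>P\<close> have their carriers in the one type \<open>'x qterm set\<close>. This loses nothing: an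
  algebra generated by the image of \<open>Xs\<close> is isomorphic to a quotient of an algebra of terms, hence
  to one with carrier in that type. The lemma \<open>free_universal\<close> below derives the universal
  property, with uniqueness, for test algebras of arbitrary type.
\<close>

definition free_nsym_medial_quandle ::
  "nat \<Rightarrow> 'x set \<Rightarrow> ('a, 'm) quandle_struct_scheme \<Rightarrow> ('x \<Rightarrow> 'a) \<Rightarrow> bool"
  where "free_nsym_medial_quandle n Xs F \<iota> \<longleftrightarrow>
    nsym_medial_quandle n F \<and> \<iota> \<in> Xs \<rightarrow> carrier F \<and> quandle_span F (\<iota> ` Xs) = carrier F \<and>
    (\<forall>(P :: 'x qterm set quandle_struct) g. nsym_medial_quandle n P \<and> g \<in> Xs \<rightarrow> carrier P \<longrightarrow>
      (\<exists>h \<in> quandle_hom F P. \<forall>x\<in>Xs. h (\<iota> x) = g x))"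


text \<open>
  The direct sum of copies of \<open>R\<close> indexed by \<open>I\<close>. The library's module record extends the ring
  record, so it has multiplicative fields; these play no role in a module.
\<close>

definition free_module :: "('r, 'm) ring_scheme \<Rightarrow> 'i set \<Rightarrow> ('r, 'i \<Rightarrow> 'r) module"
  where "free_module R I =
    \<lparr>carrier = {a \<in> \<Pi>\<^sub>E i\<in>I. carrier R. finite {i \<in> I. a i \<noteq> \<zero>\<^bsub>R\<^esub>}},
     monoid.mult = undefined, monoid.one = undefined,
     ring.zero = (\<lambda>i\<in>I. \<zero>\<^bsub>R\<^esub>), ring.add = (\<lambda>a b. \<lambda>i\<in>I. a i \<oplus>\<^bsub>R\<^esub> b i),
     module.smult = (\<lambda>c a. \<lambda>i\<in>I. c \<otimes>\<^bsub>R\<^esub> a i)\<rparr>"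

text \<open>
  \<open>Aff R A t\<close> is a quandle only if \<open>t\<close> acts invertibly on \<open>A\<close>. In \<open>affine_component I f\<close> below this
  holds whenever \<open>f\<close> divides \<open>1 + t + \<dots> + t^(n-1)\<close>, as then \<open>t^n = 1\<close> modulo \<open>f\<close>.
\<close>

definition Aff ::
  "('r, 'm) ring_scheme \<Rightarrow> ('r, 'a, 'k) module_scheme \<Rightarrow> 'r \<Rightarrow> 'a quandle_struct"
  where "Aff R A t =
    \<lparr>carrier = carrier A,
     qmult = (\<lambda>a b. (\<one>\<^bsub>R\<^esub> \<ominus>\<^bsub>R\<^esub> t) \<odot>\<^bsub>A\<^esub> a \<oplus>\<^bsub>A\<^esub> t \<odot>\<^bsub>A\<^esub> b)\<rparr>"

abbreviation Zt :: "int poly ring"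
  where "Zt \<equiv> ring_of_type_algebra"

definition Zt_mod :: "int poly \<Rightarrow> int poly set ring"
  where "Zt_mod f = Zt Quot (PIdl\<^bsub>Zt\<^esub> f)"

definition t_mod :: "int poly \<Rightarrow> int poly set"
  where "t_mod f = (PIdl\<^bsub>Zt\<^esub> f) +>\<^bsub>Zt\<^esub> [:0, 1:]"

definition affine_component :: "'x set \<Rightarrow> int poly \<Rightarrow> ('x \<Rightarrow> int poly set) quandle_struct"
  where "affine_component I f = Aff (Zt_mod f) (free_module (Zt_mod f) I) (t_mod f)"

definition unit_or_zero :: "'x set \<Rightarrow> 'x \<Rightarrow> int poly \<Rightarrow> 'x \<Rightarrow> 'x \<Rightarrow> int poly set"
  where "unit_or_zero I z f i =
    (if i = z then \<zero>\<^bsub>free_module (Zt_mod f) I\<^esub>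
     else (\<lambda>k\<in>I. if k = i then \<one>\<^bsub>Zt_mod f\<^esub> else \<zero>\<^bsub>Zt_mod f\<^esub>))"


subsection \<open>Well-definedness\<close>

context quandle
begin

lemma left_div:
  assumes "x \<in> carrier Q" "y \<in> carrier Q"
  shows left_div_closed: "left_div Q x y \<in> carrier Q"
    and mult_left_div: "x \<star> left_div Q x y = y"
  using theI'[OF left_quasi[OF assms]] by (auto simp: left_div_def)

lemma left_div_unique:
  assumes "x \<in> carrier Q" "u \<in> carrier Q" "x \<star> u = y"
  shows "left_div Q x y = u"
proof -
  have "y \<in> carrier Q" using assms by auto
  then show ?thesis
    unfolding left_div_def using assms left_quasi[of x y] by (intro the1_equality) auto
qed

lemma quandle_span_subset:
  assumes "S \<subseteq> carrier Q"
  shows "quandle_span Q S \<subseteq> carrier Q"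
proof
  fix x assume "x \<in> quandle_span Q S"
  then show "x \<in> carrier Q"
    by induction (use assms in \<open>auto simp: left_div_closed\<close>)
qed

lemma quandle_homI:
  assumes "quandle R" "h \<in> carrier Q \<rightarrow> carrier R"
    and "\<And>x y. x \<in> carrier Q \<Longrightarrow> y \<in> carrier Q \<Longrightarrow> h (x \<star> y) = h x \<star>\<^bsub>R\<^esub> h y"
  shows "h \<in> quandle_hom Q R"
proof -
  interpret R: quandle R by fact
  have "h (left_div Q x y) = left_div R (h x) (h y)" if "x \<in> carrier Q" "y \<in> carrier Q" for x y
    using assms(2) that left_div[OF that] assms(3)[of x "left_div Q x y"]
    by (intro R.left_div_unique[symmetric]) auto
  then show ?thesis using assms by (auto simp: quandle_hom_def)
qed

end

lemma (in nsym_medial_quandle) nsym_medial_quandle_generated: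
  assumes "S \<subseteq> carrier Q"
  shows "nsym_medial_quandle n (subquandle_generated Q S)"
proof -
  have sub: "\<And>x. x \<in> quandle_span Q S \<Longrightarrow> x \<in> carrier Q"
    using quandle_span_subset[OF assms] by auto
  show ?thesis
  proof unfold_locales
    fix x y assume "x \<in> carrier (subquandle_generated Q S)" "y \<in> carrier (subquandle_generated Q S)"
    then have xy: "x \<in> quandle_span Q S" "y \<in> quandle_span Q S"
      by (auto simp: subquandle_generated_def)
    have "\<exists>!u. u \<in> quandle_span Q S \<and> x \<star> u = y"
    proof (intro ex1I conjI)
      show "left_div Q x y \<in> quandle_span Q S" using xy by (rule quandle_span.ldiv)
      show "x \<star> left_div Q x y = y" using xy sub by (simp add: mult_left_div)
      show "u = left_div Q x y" if "u \<in> quandle_span Q S \<and> x \<star> u = y" for u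
        using that xy sub left_div_unique[of x u y] by auto
    qed
    then show "\<exists>!u. u \<in> carrier (subquandle_generated Q S) \<and> x \<star>\<^bsub>subquandle_generated Q S\<^esub> u = y"
      by (simp add: subquandle_generated_def)
  qed (auto simp: subquandle_generated_def sub quandle_span.mult idem n_symmetric
        intro: left_distrib medial)
qed

lemma (in nsym_medial_quandle) nsym_medial_quandle_transport:
  assumes inj: "inj_on e (carrier Q)"
  defines "d \<equiv> inv_into (carrier Q) e"
  defines "P \<equiv> \<lparr>carrier = e ` carrier Q, qmult = (\<lambda>a b. e (d a \<star> d b))\<rparr>"
  shows "nsym_medial_quandle n P"
proof -
  have d [simp]: "d (e x) = x" if "x \<in> carrier Q" for x
    using inj that by (simp add: d_def)
  show ?thesis
  proof unfold_locales
    fix a b assume "a \<in> carrier P" "b \<in> carrier P"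
    then obtain x y where xy: "a = e x" "b = e y" "x \<in> carrier Q" "y \<in> carrier Q"
      by (auto simp: P_def)
    have "\<exists>!v. v \<in> e ` carrier Q \<and> e (d a \<star> d v) = b"
    proof (intro ex1I[of _ "e (left_div Q x y)"])
      show "e (left_div Q x y) \<in> e ` carrier Q \<and> e (d a \<star> d (e (left_div Q x y))) = b"
        using xy left_div[of x y] by auto
      fix v assume v: "v \<in> e ` carrier Q \<and> e (d a \<star> d v) = b"
      then obtain u where u: "v = e u" "u \<in> carrier Q" by auto
      have "x \<star> u = y"
        using v u xy inj by (auto dest: inj_onD)
      then show "v = e (left_div Q x y)" using u xy left_div_unique[of x u y] by simp
    qed
    then show "\<exists>!v. v \<in> carrier P \<and> a \<star>\<^bsub>P\<^esub> v = b" by (simp add: P_def)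
    have "((\<lambda>u. x \<star> u) ^^ k) y \<in> carrier Q \<and>
        ((\<lambda>v. a \<star>\<^bsub>P\<^esub> v) ^^ k) b = e (((\<lambda>u. x \<star> u) ^^ k) y)" for k
      by (induction k) (use xy in \<open>auto simp: P_def\<close>)
    then show "((\<lambda>v. a \<star>\<^bsub>P\<^esub> v) ^^ n) b = b" using xy by (simp add: n_symmetric)
  qed (auto simp: P_def idem intro!: arg_cong[of _ _ e] intro: left_distrib medial)
qed

lemma free_universal:
  fixes Xs :: "'x set" and P :: "'p quandle_struct"
  assumes free: "free_nsym_medial_quandle n Xs F \<iota>"
    and P: "nsym_medial_quandle n P" and g: "g \<in> Xs \<rightarrow> carrier P"
  shows "\<exists>!h. h \<in> quandle_hom F P \<inter> extensional (carrier F) \<and> (\<forall>x\<in>Xs. h (\<iota> x) = g x)"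
proof -
  interpret F: nsym_medial_quandle n F
    using free by (simp add: free_nsym_medial_quandle_def)
  interpret P: nsym_medial_quandle n P by fact
  have \<iota>: "\<iota> \<in> Xs \<rightarrow> carrier F" and span: "quandle_span F (\<iota> ` Xs) = carrier F"
    using free by (auto simp: free_nsym_medial_quandle_def)
  define G where "G = subquandle_generated P (g ` Xs)"
  have gX: "g ` Xs \<subseteq> carrier P" using g by auto
  interpret G: nsym_medial_quandle n G
    unfolding G_def using gX by (rule P.nsym_medial_quandle_generated)
  have cG: "carrier G = quandle_span P (g ` Xs)" and mG: "qmult G = qmult P"
    by (auto simp: G_def subquandle_generated_def)
  define ev where "ev = rec_qterm g (\<lambda>_ _ a b. a \<star>\<^bsub>P\<^esub> b) (\<lambda>_ _ a b. left_div P a b)"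
  have ev [simp]: "ev (Var x) = g x" "ev (Mult s u) = ev s \<star>\<^bsub>P\<^esub> ev u"
    "ev (LDiv s u) = left_div P (ev s) (ev u)" for x s u
    by (simp_all add: ev_def)
  define e where "e p = {s. set_qterm s \<subseteq> Xs \<and> ev s = p}" for p
  have ne: "e p \<noteq> {}" if "p \<in> carrier G" for p
  proof -
    have "\<exists>s. set_qterm s \<subseteq> Xs \<and> ev s = p"
      using that unfolding cG
    proof induction
      case (base x)
      then obtain y where "y \<in> Xs" "x = g y" by auto
      then show ?case by (intro exI[of _ "Var y"]) auto
    next
      case (mult x y)
      then obtain s u where "set_qterm s \<subseteq> Xs \<and> ev s = x" "set_qterm u \<subseteq> Xs \<and> ev u = y" by auto
      then show ?case by (intro exI[of _ "Mult s u"]) auto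
    next
      case (ldiv x y)
      then obtain s u where "set_qterm s \<subseteq> Xs \<and> ev s = x" "set_qterm u \<subseteq> Xs \<and> ev u = y" by auto
      then show ?case by (intro exI[of _ "LDiv s u"]) auto
    qed
    then show ?thesis by (auto simp: e_def)
  qed
  have inj: "inj_on e (carrier G)"
  proof (rule inj_onI)
    fix p q assume "p \<in> carrier G" "e p = e q"
    then obtain s where "s \<in> e p" "s \<in> e q" using ne by blast
    then show "p = q" by (simp add: e_def)
  qed
  define d where "d = inv_into (carrier G) e"
  have d [simp]: "d (e p) = p" if "p \<in> carrier G" for p
    using inj that by (simp add: d_def)
  define E where "E = \<lparr>carrier = e ` carrier G, qmult = (\<lambda>a b. e (d a \<star>\<^bsub>G\<^esub> d b))\<rparr>"
  have "nsym_medial_quandle n E"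
    unfolding E_def d_def using inj by (rule G.nsym_medial_quandle_transport)
  moreover have gG: "g x \<in> carrier G" if "x \<in> Xs" for x
    using that by (auto simp: cG intro: quandle_span.base)
  moreover have "(\<lambda>x. e (g x)) \<in> Xs \<rightarrow> carrier E"
    using gG by (auto simp: E_def)
  ultimately obtain h where h: "h \<in> quandle_hom F E" "\<And>x. x \<in> Xs \<Longrightarrow> h (\<iota> x) = e (g x)"
    using free unfolding free_nsym_medial_quandle_def by blast
  have hE: "h a \<in> e ` carrier G" if "a \<in> carrier F" for a
    using h(1) that by (auto simp: quandle_hom_def E_def)
  have dG: "d v \<in> carrier G" if "v \<in> e ` carrier G" for v
    using that by auto
  have GP: "a \<in> carrier P" if "a \<in> carrier G" for a
    using P.quandle_span_subset[OF gX] that by (auto simp: cG)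
  define k where "k = restrict (\<lambda>a. d (h a)) (carrier F)"
  have "k \<in> quandle_hom F P"
  proof (rule F.quandle_homI)
    show "quandle P" by unfold_locales
    show "k \<in> carrier F \<rightarrow> carrier P" using hE dG GP by (auto simp: k_def)
    fix x y assume xy: "x \<in> carrier F" "y \<in> carrier F"
    have "h (x \<star>\<^bsub>F\<^esub> y) = e (d (h x) \<star>\<^bsub>G\<^esub> d (h y))"
      using h(1) xy by (auto simp: quandle_hom_def E_def)
    then show "k (x \<star>\<^bsub>F\<^esub> y) = k x \<star>\<^bsub>P\<^esub> k y"
      using xy dG[OF hE[OF xy(1)]] dG[OF hE[OF xy(2)]] G.closed[of "d (h x)" "d (h y)"]
      by (simp add: k_def mG)
  qed
  moreover have "\<forall>x\<in>Xs. k (\<iota> x) = g x" using \<iota> h(2) gG by (auto simp: k_def)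
  moreover have "k \<in> extensional (carrier F)" by (simp add: k_def)
  moreover have "k1 = k2" if k1: "k1 \<in> quandle_hom F P" "k1 \<in> extensional (carrier F)" "\<forall>x\<in>Xs. k1 (\<iota> x) = g x"
    and k2: "k2 \<in> quandle_hom F P" "k2 \<in> extensional (carrier F)" "\<forall>x\<in>Xs. k2 (\<iota> x) = g x" for k1 k2
  proof (rule extensionalityI)
    fix a assume "a \<in> carrier F"
    then have "a \<in> quandle_span F (\<iota> ` Xs)" by (simp add: span)
    then show "k1 a = k2 a"
      by induction (use k1 k2 span in \<open>auto simp: quandle_hom_def\<close>)
  qed (use k1 k2 in auto)
  ultimately show ?thesis by blast
qed

end

theory Submission
  imports Defs "HOL-Combinatorics.Permutations"
begin

text \<open>
  In a medial quandle \<open>Q\<close> the quotients \<open>L\<^sub>x L\<^sub>y\<^sup>-\<^sup>1\<close> of left translations commute, so they generate an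
  abelian group \<open>Dis\<close>, on which \<open>t\<close> acts as conjugation by \<open>L\<^sub>z\<close>. If \<open>Q\<close> is \<open>n\<close>-symmetric, then
  \<open>\<sigma> = 1 + t + \<dots> + t^(n-1)\<close> sends \<open>d\<^sub>i = L\<^sub>i L\<^sub>z\<^sup>-\<^sup>1\<close> to \<open>L\<^sub>i^n L\<^sub>z^(-n) = 1\<close>; so \<open>e\<^sub>i \<mapsto> d\<^sub>i\<close> defines a
  homomorphism \<open>\<phi>\<close> to \<open>Dis\<close> from the direct sum of copies of \<open>\<int>[t]/(\<sigma>)\<close>. Every element of the free
  quandle is of the form \<open>\<phi>(m)(i)\<close> with a generator \<open>i\<close>, and the homomorphism to the product maps it
  to the class of \<open>e\<^sub>i + (1 - t) m\<close>. That class determines \<open>i\<close> and \<open>m\<close> modulo \<open>\<sigma>\<close>, by evaluation at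
  \<open>t = 1\<close>, where \<open>\<sigma>\<close> takes the value \<open>n \<ge> 2\<close>, and because the irreducible factors of \<open>\<sigma>\<close> are pairwise
  non-associated (\<open>t^n - 1\<close> has no multiple factors).
\<close>

section \<open>Polynomials\<close>

abbreviation geom_poly :: "nat \<Rightarrow> int poly"
  where "geom_poly n \<equiv> (\<Sum>r<n. [:0, 1:] ^ r)"

lemma geom_poly_eq: "(1 - [:0, 1:]) * geom_poly n = 1 - [:0, 1:] ^ n"
  using one_diff_power_eq[of "[:0, 1:] :: int poly" n] by simp

lemma geom_poly_dvd: "geom_poly n dvd [:0, 1:] ^ n - 1"
  using geom_poly_eq[of n] by (metis dvd_triv_right dvd_minus_iff minus_diff_eq)

lemma poly_geom_poly_1 [simp]: "poly (geom_poly n) 1 = int n"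
  by (simp add: poly_sum)

text \<open>In \<open>(1 - t) * w = \<sigma> * v\<close>, evaluation at 1 gives
  \<open>n * v(1) = 0\<close>. As n is nonzero, \<open>t - 1\<close> divides \<open>v\<close> and
  can be cancelled from both sides.\<close>

lemma geom_poly_dvd_cancel:
  assumes "n > 0" and "geom_poly n dvd (1 - [:0, 1:]) * w"
  shows "geom_poly n dvd w"
proof -
  obtain v where v: "(1 - [:0, 1:]) * w = geom_poly n * v"
    using assms(2) by (elim dvdE)
  have "poly ((1 - [:0, 1:]) * w) 1 = 0" by simp
  then have "poly v 1 = 0"
    using assms(1) unfolding v by simp
  then have "[:-1, 1:] dvd v" by (simp add: poly_eq_0_iff_dvd)
  then obtain u where u: "v = [:-1, 1:] * u" by (elim dvdE)
  have "[:-1, 1:] = - (1 - [:0, 1:] :: int poly)" by (simp add: one_pCons)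
  then have "(1 - [:0, 1:]) * w = (1 - [:0, 1:]) * (- geom_poly n * u)"
    unfolding v u by (simp add: algebra_simps)
  moreover have "1 - [:0, 1:] \<noteq> (0 :: int poly)" by (simp add: one_pCons)
  ultimately have "w = - geom_poly n * u"
    by (simp only: mult_cancel_left) simp
  then show ?thesis by simp
qed

text \<open>At \<open>t = 1\<close> the multiple of \<open>1 - t\<close> vanishes and \<sigma> takes
  the value n, so n would divide \<open>c\<close>. Both signs of \<open>c\<close> are covered
  because either of two unit vectors may be the one subtracted.\<close>

lemma geom_poly_not_dvd:
  assumes "n > 1" and "\<bar>c\<bar> = 1"
  shows "\<not> geom_poly n dvd [:c:] + (1 - [:0, 1:]) * w"
proof
  assume "geom_poly n dvd [:c:] + (1 - [:0, 1:]) * w"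
  then obtain v where "[:c:] + (1 - [:0, 1:]) * w = geom_poly n * v" by (elim dvdE)
  then have "poly ([:c:] + (1 - [:0, 1:]) * w) 1 = poly (geom_poly n * v) 1" by simp
  then have "int n dvd \<bar>c\<bar>" by simp
  with assms show False by simp
qed

text \<open>If the square of \<open>p\<close> divided \<sigma>, it would divide
  \<open>t^n - 1\<close>, and \<open>p\<close> would also divide the derivative
  \<open>n * t^(n-1)\<close>. Then \<open>p\<close> divides the integer n, so it is constant; as it
  divides the constant coefficient 1 of \<sigma>, it is a unit.\<close>

lemma irreducible_factor_geom_poly_simple:
  assumes "n > 0" and p: "Factorial_Ring.irreducible p" and pq: "p * q = geom_poly n"
  shows "\<not> p dvd q"
proof
  let ?t = "[:0, 1:] :: int poly"
  assume "p dvd q"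
  then obtain s where s: "q = p * s" by (elim dvdE)
  obtain v where v: "?t ^ n - 1 = geom_poly n * v"
    using geom_poly_dvd[of n] by (elim dvdE)
  have *: "?t ^ n - 1 = p * (p * (s * v))"
    unfolding v pq[symmetric] s by (simp add: mult.assoc)
  then have "pderiv (?t ^ n - 1) = p * pderiv (p * (s * v)) + p * (s * v) * pderiv p"
    by (simp add: pderiv_mult)
  then have "p dvd pderiv (?t ^ n - 1)" by (simp add: mult.assoc)
  moreover have "pderiv (?t ^ n - 1) = of_nat n * ?t ^ (n - 1)"
    by (simp add: pderiv_power pderiv_diff pderiv_pCons of_nat_poly)
  ultimately have "p dvd of_nat n * ?t ^ (n - 1)" by (simp only:)
  \<comment> \<open>Multiplication by \<open>t\<close> turns the derivative into
    \<open>n * t^n\<close>, which differs from \<open>n * (t^n - 1)\<close>, another multiple of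
    \<open>p\<close>, by exactly n.\<close>
  then have "p dvd ?t * (of_nat n * ?t ^ (n - 1))" by (rule dvd_mult)
  also have "?t * (of_nat n * ?t ^ (n - 1)) = of_nat n * (?t * ?t ^ (n - 1))"
    by (rule mult.left_commute)
  also have "?t * ?t ^ (n - 1) = ?t ^ n"
    using \<open>n > 0\<close> by (simp only: power_Suc[symmetric] Suc_diff_1)
  finally have "p dvd of_nat n * ?t ^ n" .
  moreover have "p dvd of_nat n * (?t ^ n - 1)"
    unfolding * by (intro dvd_mult dvd_triv_left)
  ultimately have "p dvd of_nat n * ?t ^ n - of_nat n * (?t ^ n - 1)"
    by (rule dvd_diff)
  also have "of_nat n * ?t ^ n - of_nat n * (?t ^ n - 1) = of_nat n"
    by (simp add: right_diff_distrib)
  finally have "degree p \<le> degree (of_nat n :: int poly)"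
    using \<open>n > 0\<close> by (intro dvd_imp_degree_le) simp_all
  then have "degree p = 0" by simp
  then obtain c where c: "p = [:c:]" by (elim degree_eq_zeroE)
  have "c * poly q 0 = poly (geom_poly n) 0"
    unfolding pq[symmetric] c by simp
  also have "\<dots> = 1"
    using \<open>n > 0\<close> by (simp add: poly_sum power_0_left)
  finally have "c dvd 1" by (metis dvd_triv_left)
  then have "p dvd 1" by (simp add: c is_unit_const_poly_iff)
  with p show False by (simp add: irreducible_def)
qed

section \<open>Divisibility by a product of distinct primes\<close>

lemma prime_elem_dvd_prodD:
  assumes "finite A" "prime_elem p" "p dvd prod f A"
  shows "\<exists>x\<in>A. p dvd f x"
  using assms by (induction A rule: finite_induct) (auto simp: prime_elem_dvd_mult_iff prime_elem_not_unit)

text \<open>Induction over the index set: a prime \<open>f j\<close> that divides none of the other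
  factors does not divide their product, so it divides the remaining cofactor of
  \<open>w\<close>.\<close>

lemma prod_primes_dvd:
  fixes f :: "'j \<Rightarrow> 'b :: comm_semiring_1"
  assumes "finite J" "\<And>j. j \<in> J \<Longrightarrow> prime_elem (f j)"
    and "\<And>j k. j \<in> J \<Longrightarrow> k \<in> J \<Longrightarrow> j \<noteq> k \<Longrightarrow> \<not> f j dvd f k"
    and "\<And>j. j \<in> J \<Longrightarrow> f j dvd w"
  shows "prod f J dvd w"
  using assms
proof (induction J rule: finite_induct)
  case (insert j K)
  then obtain v where v: "w = prod f K * v" by (elim meta_impE) (auto elim: dvdE)
  have pj: "prime_elem (f j)" using insert.prems by simp
  have "\<not> f j dvd prod f K"
    using insert.prems(2) insert.hyps prime_elem_dvd_prodD[OF insert.hyps(1) pj, of f] by fastforce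
  moreover have "f j dvd prod f K * v" using insert.prems(3)[of j] v by simp
  ultimately have "f j dvd v" using pj by (simp add: prime_elem_dvd_mult_iff)
  then show ?case
    unfolding v using insert.hyps by (simp add: mult.commute mult_dvd_mono)
qed auto

text \<open>Irreducible elements of \<int>[t] are prime. Simplicity of the factors keeps them apart:
  if \<open>f j\<close> divided \<open>f k\<close>, it would divide its own cofactor in
  \<sigma>.\<close>

lemma geom_poly_dvd_if_irreducible_factors_dvd:
  assumes "n > 0" "finite J" and f: "geom_poly n = (\<Prod>j\<in>J. f j)"
    and irr: "\<And>j. j \<in> J \<Longrightarrow> Factorial_Ring.irreducible (f j)"
    and "\<And>j. j \<in> J \<Longrightarrow> f j dvd w"
  shows "geom_poly n dvd w"
  unfolding f
proof (rule prod_primes_dvd)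
  show "prime_elem (f j)" if "j \<in> J" for j
    using irr[OF that] by (rule irreducible_imp_prime_elem_gcd)
  fix j k assume jk: "j \<in> J" "k \<in> J" "j \<noteq> k"
  have "f j * prod f (J - {j}) = geom_poly n"
    unfolding f using assms(2) jk(1) by (simp add: prod.remove)
  then have "\<not> f j dvd prod f (J - {j})"
    using irreducible_factor_geom_poly_simple[OF \<open>n > 0\<close> irr[OF jk(1)]] by blast
  moreover have "f k dvd prod f (J - {j})"
    using assms(2) jk by (intro dvd_prodI) auto
  ultimately show "\<not> f j dvd f k"
    by (blast intro: dvd_trans)
qed (use assms in auto)


section \<open>Affine quandles and products\<close>

text \<open>Left division by \<open>x\<close> is left multiplication by \<open>x\<close> iterated n
  - 1 times, and left distributivity is mediality with equal first two arguments, simplified by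
  idempotence.\<close>

lemma nsym_medial_quandleI:
  fixes Q (structure)
  assumes n: "n > 0"
    and closed: "\<And>x y. \<lbrakk>x \<in> carrier Q; y \<in> carrier Q\<rbrakk> \<Longrightarrow> x \<star> y \<in> carrier Q"
    and idem: "\<And>x. x \<in> carrier Q \<Longrightarrow> x \<star> x = x"
    and medial: "\<And>x y u v. \<lbrakk>x \<in> carrier Q; y \<in> carrier Q; u \<in> carrier Q; v \<in> carrier Q\<rbrakk>
      \<Longrightarrow> (x \<star> y) \<star> (u \<star> v) = (x \<star> u) \<star> (y \<star> v)"
    and sym: "\<And>x y. \<lbrakk>x \<in> carrier Q; y \<in> carrier Q\<rbrakk> \<Longrightarrow> ((\<lambda>u. x \<star> u) ^^ n) y = y"
  shows "nsym_medial_quandle n Q"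
proof unfold_locales
  fix x y assume xy: "x \<in> carrier Q" "y \<in> carrier Q"
  obtain m where m: "n = Suc m" using n by (cases n) auto
  have pow: "((\<lambda>u. x \<star> u) ^^ k) y \<in> carrier Q" for k
    by (induction k) (use xy closed in auto)
  show "\<exists>!u. u \<in> carrier Q \<and> x \<star> u = y"
  proof (intro ex1I conjI)
    show "((\<lambda>u. x \<star> u) ^^ m) y \<in> carrier Q" by (rule pow)
    show "x \<star> ((\<lambda>u. x \<star> u) ^^ m) y = y" using sym[OF xy] by (simp add: m)
    show "v = ((\<lambda>u. x \<star> u) ^^ m) y" if "v \<in> carrier Q \<and> x \<star> v = y" for v
      using that sym[of x v] xy by (simp add: m funpow_Suc_right del: funpow.simps)
  qed
next
  fix x y w assume "x \<in> carrier Q" "y \<in> carrier Q" "w \<in> carrier Q"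
  then show "x \<star> (y \<star> w) = (x \<star> y) \<star> (x \<star> w)"
    using medial[of x x y w] idem by simp
qed (use assms in auto)

lemma carrier_Aff_free_module [simp]:
  "carrier (Aff R (free_module R I) t) = {a \<in> \<Pi>\<^sub>E i\<in>I. carrier R. finite {i \<in> I. a i \<noteq> \<zero>\<^bsub>R\<^esub>}}"
  by (simp add: Aff_def free_module_def)

lemma qmult_Aff_free_module [simp]:
  "a \<star>\<^bsub>Aff R (free_module R I) t\<^esub> b =
    (\<lambda>i\<in>I. (\<one>\<^bsub>R\<^esub> \<ominus>\<^bsub>R\<^esub> t) \<otimes>\<^bsub>R\<^esub> a i \<oplus>\<^bsub>R\<^esub> t \<otimes>\<^bsub>R\<^esub> b i)"
  by (auto simp: Aff_def free_module_def restrict_def fun_eq_iff)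

text \<open>Left multiplication by \<open>x\<close> fixes \<open>x\<close> and scales differences
  from \<open>x\<close> by \<open>t\<close>. Its k-th iterate is therefore
  \<open>y \<mapsto> x + t^k (y - x)\<close>, and \<open>t^n = 1\<close> gives n-symmetry.
  Idempotence and mediality are ring identities in each coordinate.\<close>

lemma (in cring) nsym_medial_quandle_Aff:
  assumes t: "t \<in> carrier R" and tn: "t [^] n = \<one>" and n: "n > 0"
  shows "nsym_medial_quandle n (Aff R (free_module R I) t)" (is "nsym_medial_quandle n ?A")
proof (rule nsym_medial_quandleI[OF n])
  have A: "a i \<in> carrier R" if "a \<in> carrier ?A" "i \<in> I" for a i
    using that by auto
  have ext: "(\<lambda>i\<in>I. a i) = a" if "a \<in> carrier ?A" for a
    using that by (simp add: PiE_def extensional_restrict)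
  fix x y assume xy: "x \<in> carrier ?A" "y \<in> carrier ?A"
  have "{i \<in> I. (\<one> \<ominus> t) \<otimes> x i \<oplus> t \<otimes> y i \<noteq> \<zero>} \<subseteq> {i \<in> I. x i \<noteq> \<zero>} \<union> {i \<in> I. y i \<noteq> \<zero>}"
    using t by auto
  then have "finite {i \<in> I. (\<one> \<ominus> t) \<otimes> x i \<oplus> t \<otimes> y i \<noteq> \<zero>}"
    by (rule finite_subset) (use xy in auto)
  then show "x \<star>\<^bsub>?A\<^esub> y \<in> carrier ?A"
    using t A[OF xy(1)] A[OF xy(2)] by (auto cong: conj_cong)
  have "(\<lambda>i\<in>I. (\<one> \<ominus> t) \<otimes> x i \<oplus> t \<otimes> x i) = (\<lambda>i\<in>I. x i)"
  proof (rule restrict_ext)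
    fix i assume "i \<in> I"
    then have "x i \<in> carrier R" by (rule A[OF xy(1)])
    then show "(\<one> \<ominus> t) \<otimes> x i \<oplus> t \<otimes> x i = x i" using t by algebra
  qed
  then show "x \<star>\<^bsub>?A\<^esub> x = x" using ext[OF xy(1)] by simp
  have pow: "((\<lambda>u. x \<star>\<^bsub>?A\<^esub> u) ^^ k) y = (\<lambda>i\<in>I. x i \<oplus> t [^] k \<otimes> (y i \<ominus> x i))" for k
  proof (induction k)
    case 0
    have "(\<lambda>i\<in>I. x i \<oplus> t [^] (0::nat) \<otimes> (y i \<ominus> x i)) = (\<lambda>i\<in>I. y i)"
    proof (rule restrict_ext)
      fix i assume "i \<in> I"
      then have "x i \<in> carrier R" "y i \<in> carrier R" using A xy by blast+
      then show "x i \<oplus> t [^] (0::nat) \<otimes> (y i \<ominus> x i) = y i" by (simp, algebra)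
    qed
    then show ?case using ext[OF xy(2)] by simp
  next
    case (Suc k)
    have "(\<lambda>i\<in>I. (\<one> \<ominus> t) \<otimes> x i \<oplus> t \<otimes> (x i \<oplus> t [^] k \<otimes> (y i \<ominus> x i)))
      = (\<lambda>i\<in>I. x i \<oplus> t [^] Suc k \<otimes> (y i \<ominus> x i))"
    proof (rule restrict_ext)
      fix i assume "i \<in> I"
      then have c: "x i \<in> carrier R" "y i \<in> carrier R" "t [^] k \<in> carrier R" using A xy t by auto
      have "(\<one> \<ominus> t) \<otimes> x i \<oplus> t \<otimes> (x i \<oplus> u \<otimes> (y i \<ominus> x i)) = x i \<oplus> (u \<otimes> t) \<otimes> (y i \<ominus> x i)"
        if "u \<in> carrier R" for u
        using t c that by algebra
      then show "(\<one> \<ominus> t) \<otimes> x i \<oplus> t \<otimes> (x i \<oplus> t [^] k \<otimes> (y i \<ominus> x i))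
        = x i \<oplus> t [^] Suc k \<otimes> (y i \<ominus> x i)" using c by simp
    qed
    then show ?case
      unfolding funpow.simps o_apply Suc
      unfolding qmult_Aff_free_module by (simp cong: restrict_cong)
  qed
  show "((\<lambda>u. x \<star>\<^bsub>?A\<^esub> u) ^^ n) y = y"
  proof -
    have "(\<lambda>i\<in>I. x i \<oplus> t [^] n \<otimes> (y i \<ominus> x i)) = (\<lambda>i\<in>I. y i)"
    proof (rule restrict_ext)
      fix i assume "i \<in> I"
      then have "x i \<in> carrier R" "y i \<in> carrier R" using A xy by blast+
      then show "x i \<oplus> t [^] n \<otimes> (y i \<ominus> x i) = y i" unfolding tn by (simp, algebra)
    qed
    then show ?thesis unfolding pow using ext[OF xy(2)] by simp
  qed
  fix u v assume uv: "u \<in> carrier ?A" "v \<in> carrier ?A"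
  show "(x \<star>\<^bsub>?A\<^esub> y) \<star>\<^bsub>?A\<^esub> (u \<star>\<^bsub>?A\<^esub> v) = (x \<star>\<^bsub>?A\<^esub> u) \<star>\<^bsub>?A\<^esub> (y \<star>\<^bsub>?A\<^esub> v)"
    unfolding qmult_Aff_free_module
  proof (rule restrict_ext)
    fix i assume i: "i \<in> I"
    then have "x i \<in> carrier R" "y i \<in> carrier R" "u i \<in> carrier R" "v i \<in> carrier R"
      using A xy uv by blast+
    with t have "(\<one> \<ominus> t) \<otimes> ((\<one> \<ominus> t) \<otimes> x i \<oplus> t \<otimes> y i) \<oplus> t \<otimes> ((\<one> \<ominus> t) \<otimes> u i \<oplus> t \<otimes> v i)
      = (\<one> \<ominus> t) \<otimes> ((\<one> \<ominus> t) \<otimes> x i \<oplus> t \<otimes> u i) \<oplus> t \<otimes> ((\<one> \<ominus> t) \<otimes> y i \<oplus> t \<otimes> v i)"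
      by algebra
    then show "(\<one> \<ominus> t) \<otimes> (\<lambda>i\<in>I. (\<one> \<ominus> t) \<otimes> x i \<oplus> t \<otimes> y i) i
        \<oplus> t \<otimes> (\<lambda>i\<in>I. (\<one> \<ominus> t) \<otimes> u i \<oplus> t \<otimes> v i) i
      = (\<one> \<ominus> t) \<otimes> (\<lambda>i\<in>I. (\<one> \<ominus> t) \<otimes> x i \<oplus> t \<otimes> u i) i
        \<oplus> t \<otimes> (\<lambda>i\<in>I. (\<one> \<ominus> t) \<otimes> y i \<oplus> t \<otimes> v i) i"
      using i by simp
  qed
qed

section \<open>Componentwise products\<close>

lemma carrier_quandle_prod [simp]: "carrier (quandle_prod J M) = (\<Pi>\<^sub>E j\<in>J. carrier (M j))"
  and qmult_quandle_prod [simp]: "a \<star>\<^bsub>quandle_prod J M\<^esub> b = (\<lambda>j\<in>J. a j \<star>\<^bsub>M j\<^esub> b j)"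
  by (simp_all add: quandle_prod_def)

lemma nsym_medial_quandle_prod:
  assumes n: "n > 0" and M: "\<And>j. j \<in> J \<Longrightarrow> nsym_medial_quandle n (M j)"
  shows "nsym_medial_quandle n (quandle_prod J M)" (is "nsym_medial_quandle n ?P")
proof (rule nsym_medial_quandleI[OF n])
  have q: "quandle (M j)" if "j \<in> J" for j
    using M[OF that] by (rule nsym_medial_quandle.axioms)
  have ext: "(\<lambda>j\<in>J. a j) = a" if "a \<in> carrier ?P" for a
    using that by (simp add: PiE_def extensional_restrict)
  fix x y assume xy: "x \<in> carrier ?P" "y \<in> carrier ?P"
  then show "x \<star>\<^bsub>?P\<^esub> y \<in> carrier ?P"
    using q by (auto intro!: quandle.closed)
  have "(\<lambda>j\<in>J. x j \<star>\<^bsub>M j\<^esub> x j) = (\<lambda>j\<in>J. x j)"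
    using xy q by (intro restrict_ext quandle.idem) auto
  then show "x \<star>\<^bsub>?P\<^esub> x = x" using ext[OF xy(1)] by simp
  have pow: "((\<lambda>u. x \<star>\<^bsub>?P\<^esub> u) ^^ k) y = (\<lambda>j\<in>J. ((\<lambda>u. x j \<star>\<^bsub>M j\<^esub> u) ^^ k) (y j))" for k
  proof (induction k)
    case 0
    then show ?case using ext[OF xy(2)] by simp
  next
    case (Suc k)
    show ?case
      unfolding funpow.simps o_apply Suc
      unfolding qmult_quandle_prod by (simp cong: restrict_cong)
  qed
  have "(\<lambda>j\<in>J. ((\<lambda>u. x j \<star>\<^bsub>M j\<^esub> u) ^^ n) (y j)) = (\<lambda>j\<in>J. y j)"
    using xy M by (intro restrict_ext nsym_medial_quandle.n_symmetric) auto
  then show "((\<lambda>u. x \<star>\<^bsub>?P\<^esub> u) ^^ n) y = y"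
    unfolding pow using ext[OF xy(2)] by simp
  fix u v assume uv: "u \<in> carrier ?P" "v \<in> carrier ?P"
  show "(x \<star>\<^bsub>?P\<^esub> y) \<star>\<^bsub>?P\<^esub> (u \<star>\<^bsub>?P\<^esub> v) = (x \<star>\<^bsub>?P\<^esub> u) \<star>\<^bsub>?P\<^esub> (y \<star>\<^bsub>?P\<^esub> v)"
    unfolding qmult_quandle_prod
    by (rule restrict_ext) (use xy uv in \<open>auto intro: nsym_medial_quandle.medial[OF M]\<close>)
qed


section \<open>Cosets of integer polynomials\<close>

abbreviation coset :: "int poly \<Rightarrow> int poly \<Rightarrow> int poly set"
  where "coset f p \<equiv> (PIdl\<^bsub>Zt\<^esub> f) +>\<^bsub>Zt\<^esub> p"

lemma Zt_simps [simp]: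
  "carrier Zt = UNIV" "p \<otimes>\<^bsub>Zt\<^esub> q = p * q" "\<one>\<^bsub>Zt\<^esub> = 1" "\<zero>\<^bsub>Zt\<^esub> = 0" "p \<oplus>\<^bsub>Zt\<^esub> q = p + q"
  by (simp_all add: ring_of_type_algebra_def)

lemma cring_Zt: "cring Zt" by (rule cring_from_type_algebra)

lemma Zt_uminus [simp]: "\<ominus>\<^bsub>Zt\<^esub> p = - p"
proof -
  interpret cring Zt by (rule cring_Zt)
  show ?thesis by (rule minus_equality) auto
qed

lemma Zt_minus [simp]: "p \<ominus>\<^bsub>Zt\<^esub> q = p - q"
  by (simp add: a_minus_def)

lemma ideal_PIdl: "ideal (PIdl\<^bsub>Zt\<^esub> f) Zt"
  by (simp add: cring.cgenideal_ideal[OF cring_Zt])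

lemma coset_eq_iff: "coset f p = coset f q \<longleftrightarrow> f dvd p - q"
proof -
  interpret cring Zt by (rule cring_Zt)
  show ?thesis
    using quotient_eq_iff_same_a_r_cos[OF ideal_PIdl, of p q f]
    by (auto simp: cgenideal_def dvd_def mult.commute)
qed

lemma cring_Zt_mod: "cring (Zt_mod f)"
  unfolding Zt_mod_def using ideal_PIdl cring_Zt by (rule ideal.quotient_is_cring)

lemma coset_hom: "ring_hom_cring Zt (Zt_mod f) (coset f)"
  unfolding Zt_mod_def using ideal_PIdl cring_Zt by (rule ideal.rcos_ring_hom_cring)

context
  fixes f :: "int poly"
begin

interpretation ring_hom_cring Zt "Zt_mod f" "coset f" by (rule coset_hom)

lemma coset_closed [simp]: "coset f p \<in> carrier (Zt_mod f)"
  using hom_closed by simp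

lemma coset_add: "coset f p \<oplus>\<^bsub>Zt_mod f\<^esub> coset f q = coset f (p + q)"
  using hom_add[of p q] by simp

lemma coset_mult: "coset f p \<otimes>\<^bsub>Zt_mod f\<^esub> coset f q = coset f (p * q)"
  using hom_mult[of p q] by simp

lemma coset_zero: "\<zero>\<^bsub>Zt_mod f\<^esub> = coset f 0"
  using hom_zero by simp

lemma coset_one: "\<one>\<^bsub>Zt_mod f\<^esub> = coset f 1"
  using hom_one by simp

lemma coset_minus: "coset f p \<ominus>\<^bsub>Zt_mod f\<^esub> coset f q = coset f (p - q)"
  using hom_add[of p "-q"] hom_a_inv[of q] by (simp add: a_minus_def)

lemma coset_power: "coset f p [^]\<^bsub>Zt_mod f\<^esub> (k::nat) = coset f (p ^ k)"
  by (induction k) (simp_all add: coset_one coset_mult mult.commute)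

end

lemma nsym_medial_quandle_affine_component:
  assumes "n > 0" and "f dvd geom_poly n"
  shows "nsym_medial_quandle n (affine_component I f)"
  unfolding affine_component_def
proof (rule cring.nsym_medial_quandle_Aff[OF cring_Zt_mod])
  have "f dvd [:0, 1:] ^ n - 1"
    using assms(2) geom_poly_dvd by (rule dvd_trans)
  then show "t_mod f [^]\<^bsub>Zt_mod f\<^esub> n = \<one>\<^bsub>Zt_mod f\<^esub>"
    by (simp add: t_mod_def coset_power coset_one coset_eq_iff)
qed (use assms in \<open>simp_all add: t_mod_def\<close>)


section \<open>Abelian groups as modules over the integer polynomials\<close>

locale comm_group_endo = comm_group G for G (structure) +
  fixes c
  assumes endo: "c \<in> hom G G"
begin

text \<open>Horner evaluation of the scalar multiplication for which \<open>G\<close>, written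
  multiplicatively, is a \<int>[t]-module with \<open>t\<close> acting as \<open>c\<close>.\<close>

definition poly_act :: "int poly \<Rightarrow> 'a \<Rightarrow> 'a"
  where "poly_act p x = fold_coeffs (\<lambda>a h. x [^] a \<otimes> c h) p \<one>"

lemma endo_closed [simp]: "x \<in> carrier G \<Longrightarrow> c x \<in> carrier G"
  using endo by (rule hom_in_carrier)

lemma endo_mult: "x \<in> carrier G \<Longrightarrow> y \<in> carrier G \<Longrightarrow> c (x \<otimes> y) = c x \<otimes> c y"
  using endo by (rule hom_mult)

lemma endo_one [simp]: "c \<one> = \<one>"
  using endo by (rule hom_one) unfold_locales

lemma poly_act_0 [simp]: "poly_act 0 x = \<one>"
  by (simp add: poly_act_def)

lemma poly_act_pCons [simp]: "poly_act (pCons a p) x = x [^] a \<otimes> c (poly_act p x)"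
  if "x \<in> carrier G"
\<comment> \<open>\<open>pCons 0 0\<close> is the zero polynomial and has no coefficients to fold;
  in that case both sides are \<open>\<one>\<close>, because \<open>c\<close> preserves
  \<open>\<one>\<close>.\<close>
proof (cases "a = 0 \<and> p = 0")
  case False
  then have "fold_coeffs f (pCons a p) = f a \<circ> fold_coeffs f p" for f :: "int \<Rightarrow> 'a \<Rightarrow> 'a"
    by (cases "a = 0") auto
  then show ?thesis by (simp add: poly_act_def)
qed (simp add: that)

lemma poly_act_closed [simp]: "x \<in> carrier G \<Longrightarrow> poly_act p x \<in> carrier G"
  by (induction p) simp_all

lemma poly_act_1 [simp]: "x \<in> carrier G \<Longrightarrow> poly_act 1 x = x"
  by (simp add: one_pCons)

lemma poly_act_one [simp]: "poly_act p \<one> = \<one>"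
  by (induction p) simp_all

lemma poly_act_add: "x \<in> carrier G \<Longrightarrow> poly_act (p + q) x = poly_act p x \<otimes> poly_act q x"
proof (induction p q rule: poly_induct2)
  case (pCons a p b q)
  then show ?case by (simp add: int_pow_mult endo_mult m_ac)
qed simp

lemma poly_act_shift: "x \<in> carrier G \<Longrightarrow> poly_act ([:0, 1:] * p) x = c (poly_act p x)"
  by simp

lemma endo_int_pow: "x \<in> carrier G \<Longrightarrow> c (x [^] (a::int)) = c x [^] a"
  using endo by (intro hom_int_pow) unfold_locales

lemma poly_act_smult: "x \<in> carrier G \<Longrightarrow> poly_act (smult a p) x = poly_act p x [^] a"
proof (induction p)
  case (pCons b p)
  then show ?case
    by (simp add: int_pow_mult_distrib m_comm int_pow_pow endo_int_pow mult.commute)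
qed simp

lemma poly_act_mult: "x \<in> carrier G \<Longrightarrow> poly_act (p * q) x = poly_act p (poly_act q x)"
  by (induction p) (simp_all add: poly_act_add poly_act_smult)

lemma endo_funpow_closed [simp]: "x \<in> carrier G \<Longrightarrow> (c ^^ k) x \<in> carrier G"
  by (induction k) simp_all

lemma poly_act_power: "x \<in> carrier G \<Longrightarrow> poly_act ([:0, 1:] ^ k) x = (c ^^ k) x"
  by (induction k) (simp_all add: poly_act_mult)

section \<open>Combinations with polynomial coefficients\<close>

lemma endo_finprod:
  assumes "finite A" "f \<in> A \<rightarrow> carrier G"
  shows "c (finprod G f A) = finprod G (\<lambda>i. c (f i)) A"
  using assms by (induction A rule: finite_induct) (auto simp: Pi_iff endo_mult)

text \<open>The product runs over the support only, as \<open>I\<close> may be infinite and a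
  \<open>finprod\<close> over an infinite set is \<open>\<one>\<close> by default.\<close>

definition lincomb :: "'i set \<Rightarrow> ('i \<Rightarrow> 'a) \<Rightarrow> ('i \<Rightarrow> int poly) \<Rightarrow> 'a"
  where "lincomb I d m = (\<Otimes>i\<in>{i \<in> I. m i \<noteq> 0}. poly_act (m i) (d i))"

context
  fixes I :: "'i set" and d :: "'i \<Rightarrow> 'a"
  assumes d: "d \<in> I \<rightarrow> carrier G"
begin

lemma d_closed [simp]: "i \<in> I \<Longrightarrow> d i \<in> carrier G"
  using d by auto

text \<open>Combinations with different supports become comparable once they are padded by trivial
  factors to a common finite set \<open>S\<close>.\<close>

lemma lincomb_eq:
  assumes "finite S" "S \<subseteq> I" "\<And>i. i \<in> I - S \<Longrightarrow> m i = 0"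
  shows "lincomb I d m = (\<Otimes>i\<in>S. poly_act (m i) (d i))"
  unfolding lincomb_def
  using assms by (intro finprod_mono_neutral_cong_left) auto

lemma lincomb_closed [simp]: "lincomb I d m \<in> carrier G"
  unfolding lincomb_def by (intro finprod_closed) auto

lemma lincomb_add:
  assumes "finite {i \<in> I. m i \<noteq> 0}" "finite {i \<in> I. m' i \<noteq> 0}"
  shows "lincomb I d (\<lambda>i. m i + m' i) = lincomb I d m \<otimes> lincomb I d m'"
proof -
  define S where "S = {i \<in> I. m i \<noteq> 0} \<union> {i \<in> I. m' i \<noteq> 0}"
  have S: "finite S" "S \<subseteq> I" and dS: "\<And>i. i \<in> S \<Longrightarrow> d i \<in> carrier G"
    using assms d by (auto simp: S_def)
  have "lincomb I d (\<lambda>i. m i + m' i) = (\<Otimes>i\<in>S. poly_act (m i + m' i) (d i))"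
    using S by (intro lincomb_eq) (auto simp: S_def)
  also have "\<dots> = (\<Otimes>i\<in>S. poly_act (m i) (d i) \<otimes> poly_act (m' i) (d i))"
    using dS by (intro finprod_cong') (auto simp: poly_act_add)
  also have "\<dots> = (\<Otimes>i\<in>S. poly_act (m i) (d i)) \<otimes> (\<Otimes>i\<in>S. poly_act (m' i) (d i))"
    using dS by (intro finprod_multf) auto
  also have "\<dots> = lincomb I d m \<otimes> lincomb I d m'"
    using S by (subst (1 2) lincomb_eq[of S]) (auto simp: S_def)
  finally show ?thesis .
qed

lemma lincomb_shift:
  assumes "finite {i \<in> I. m i \<noteq> 0}"
  shows "lincomb I d (\<lambda>i. [:0, 1:] * m i) = c (lincomb I d m)"
proof -
  have "lincomb I d (\<lambda>i. [:0, 1:] * m i)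
      = (\<Otimes>i\<in>{i \<in> I. m i \<noteq> 0}. poly_act ([:0, 1:] * m i) (d i))"
    using assms by (intro lincomb_eq) auto
  also have "\<dots> = (\<Otimes>i\<in>{i \<in> I. m i \<noteq> 0}. c (poly_act (m i) (d i)))"
    by (intro finprod_cong') (auto simp: poly_act_shift simp del: mult_pCons_left)
  also have "\<dots> = c (lincomb I d m)"
    unfolding lincomb_def using assms by (subst endo_finprod) auto
  finally show ?thesis .
qed

lemma lincomb_dvd:
  assumes "\<And>i. i \<in> I \<Longrightarrow> poly_act s (d i) = \<one>" and "\<And>i. i \<in> I \<Longrightarrow> s dvd m i"
  shows "lincomb I d m = \<one>"
  unfolding lincomb_def
proof (rule finprod_one_eqI)
  fix i assume "i \<in> {i \<in> I. m i \<noteq> 0}"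
  then have i: "i \<in> I" by simp
  then obtain q where "m i = q * s" using assms(2) by (metis dvdE mult.commute)
  then show "poly_act (m i) (d i) = \<one>"
    using i assms(1) by (simp add: poly_act_mult)
qed

text \<open>If \<open>s\<close> annihilates all \<open>d i\<close>, coefficients matter only modulo
  \<open>s\<close>; this makes the combination a map on a direct sum of copies of
  \<int>[t]/(s).\<close>

lemma lincomb_eq_if_dvd_diff:
  assumes "finite {i \<in> I. m i \<noteq> 0}" "finite {i \<in> I. m' i \<noteq> 0}"
    and "\<And>i. i \<in> I \<Longrightarrow> poly_act s (d i) = \<one>" and "\<And>i. i \<in> I \<Longrightarrow> s dvd m i - m' i"
  shows "lincomb I d m = lincomb I d m'"
proof -
  have "finite {i \<in> I. m i - m' i \<noteq> 0}"
    by (rule finite_subset[of _ "{i \<in> I. m i \<noteq> 0} \<union> {i \<in> I. m' i \<noteq> 0}"]) (use assms in auto)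
  then have "lincomb I d (\<lambda>i. (m i - m' i) + m' i) = lincomb I d (\<lambda>i. m i - m' i) \<otimes> lincomb I d m'"
    using assms by (intro lincomb_add)
  also have "lincomb I d (\<lambda>i. m i - m' i) = \<one>"
    using assms by (intro lincomb_dvd)
  finally show ?thesis by simp
qed

lemma lincomb_zero [simp]: "lincomb I d (\<lambda>i. 0) = \<one>"
  by (simp add: lincomb_def)

lemma lincomb_unit:
  assumes "i \<in> I"
  shows "lincomb I d (\<lambda>k. if k = i then 1 else 0) = d i"
proof -
  have "lincomb I d (\<lambda>k. if k = i then 1 else 0) = (\<Otimes>k\<in>{i}. poly_act (if k = i then 1 else 0) (d k))"
    using assms by (intro lincomb_eq) auto
  also have "\<dots> = d i"
    using assms by (subst finprod_insert) auto
  finally show ?thesis .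
qed

end

end


section \<open>The displacement group\<close>

definition perm_group :: "'a set \<Rightarrow> ('a \<Rightarrow> 'a) monoid"
  where "perm_group S = \<lparr>carrier = {p. p permutes S}, monoid.mult = (\<circ>), one = id\<rparr>"

lemma in_perm_group_iff: "p \<in> carrier (perm_group S) \<longleftrightarrow> p permutes S"
  by (simp add: perm_group_def)

lemma perm_group_mult_apply: "(p \<otimes>\<^bsub>perm_group S\<^esub> q) x = p (q x)"
  and perm_group_one_apply: "\<one>\<^bsub>perm_group S\<^esub> x = x"
  by (simp_all add: perm_group_def)

lemmas perm_group_apply = perm_group_mult_apply perm_group_one_apply

lemma group_perm_group: "group (perm_group S)"
proof (rule groupI)
  fix p assume "p \<in> carrier (perm_group S)"
  then have p: "p permutes S" by (simp add: in_perm_group_iff)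
  show "\<exists>q\<in>carrier (perm_group S). q \<otimes>\<^bsub>perm_group S\<^esub> p = \<one>\<^bsub>perm_group S\<^esub>"
    using permutes_inv[OF p] permutes_inv_o[OF p] by (auto simp: perm_group_def)
qed (auto simp: perm_group_def permutes_compose permutes_id o_assoc)

lemma perm_group_apply_closed: "p \<in> carrier (perm_group S) \<Longrightarrow> x \<in> S \<Longrightarrow> p x \<in> S"
  by (simp add: in_perm_group_iff permutes_in_image)

lemma perm_group_apply_outside: "p \<in> carrier (perm_group S) \<Longrightarrow> x \<notin> S \<Longrightarrow> p x = x"
  by (simp add: in_perm_group_iff permutes_not_in)

lemma perm_group_inv_apply [simp]:
  assumes "p \<in> carrier (perm_group S)"
  shows "(inv\<^bsub>perm_group S\<^esub> p) (p x) = x" and "p ((inv\<^bsub>perm_group S\<^esub> p) x) = x"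
proof -
  interpret group "perm_group S" by (rule group_perm_group)
  show "(inv\<^bsub>perm_group S\<^esub> p) (p x) = x" "p ((inv\<^bsub>perm_group S\<^esub> p) x) = x"
    using fun_cong[OF l_inv[OF assms], of x] fun_cong[OF r_inv[OF assms], of x]
    by (simp_all add: perm_group_apply)
qed

text \<open>Two applications of centralizers, written \<open>?C\<close>: the centralizer of
  \<open>H\<close> is a subgroup containing \<open>H\<close>, hence contains the generated subgroup
  \<open>?D\<close>. So \<open>H\<close> lies in the centralizer of \<open>?D\<close>, and since
  that is a subgroup too, it contains all of \<open>?D\<close>.\<close>

lemma (in group) comm_group_subgroup_generated:
  assumes H: "H \<subseteq> carrier G" and comm: "\<And>x y. x \<in> H \<Longrightarrow> y \<in> H \<Longrightarrow> x \<otimes> y = y \<otimes> x"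
  shows "comm_group (subgroup_generated G H)"
proof -
  let ?C = "\<lambda>A. {x \<in> carrier G. \<forall>y\<in>A. x \<otimes> y = y \<otimes> x}"
  have sub: "subgroup (?C A) G" if A: "A \<subseteq> carrier G" for A
  proof (rule subgroupI)
    have "\<one> \<in> ?C A" using A by auto
    then show "?C A \<noteq> {}" by blast
    fix x assume x: "x \<in> ?C A"
    have "inv x \<otimes> y = y \<otimes> inv x" if "y \<in> A" for y
    proof -
      have y: "y \<in> carrier G" using A that by auto
      have "inv x \<otimes> y = inv x \<otimes> ((y \<otimes> x) \<otimes> inv x)"
        using x y by (simp add: m_assoc)
      also have "y \<otimes> x = x \<otimes> y" using x that by simp
      also have "inv x \<otimes> ((x \<otimes> y) \<otimes> inv x) = y \<otimes> inv x"
        using x y by (simp add: m_assoc[symmetric])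
      finally show ?thesis .
    qed
    then show "inv x \<in> ?C A" using x by simp
    fix y assume y: "y \<in> ?C A"
    have "x \<otimes> y \<otimes> u = u \<otimes> (x \<otimes> y)" if "u \<in> A" for u
    proof -
      have "u \<in> carrier G" using A that by auto
      then have "x \<otimes> y \<otimes> u = x \<otimes> (u \<otimes> y)" "x \<otimes> (u \<otimes> y) = (u \<otimes> x) \<otimes> y"
        using x y that m_assoc[of x u y] by (simp_all add: m_assoc)
      then show ?thesis using \<open>u \<in> carrier G\<close> x y by (simp add: m_assoc)
    qed
    then show "x \<otimes> y \<in> ?C A" using x y by simp
  qed auto
  let ?D = "generate G H"
  have "H \<subseteq> ?C H" using H comm by blast
  then have DH: "?D \<subseteq> ?C H" by (rule generate_subgroup_incl[OF _ sub[OF H]])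
  have "H \<subseteq> ?C ?D"
  proof
    fix x assume x: "x \<in> H"
    then have "x \<otimes> y = y \<otimes> x" if "y \<in> ?D" for y
      using DH that by force
    then show "x \<in> ?C ?D" using x H by blast
  qed
  then have DC: "?D \<subseteq> ?C ?D"
    by (rule generate_subgroup_incl[OF _ sub[OF generate_incl[OF H]]])
  have D: "carrier (subgroup_generated G H) = ?D"
    using H by (simp add: carrier_subgroup_generated Int_absorb1)
  show ?thesis
  proof (rule group.group_comm_groupI[OF group_subgroup_generated])
    fix x y assume "x \<in> carrier (subgroup_generated G H)" "y \<in> carrier (subgroup_generated G H)"
    then have "x \<in> ?C ?D" "y \<in> ?D" unfolding D using DC by blast+
    then show "x \<otimes>\<^bsub>subgroup_generated G H\<^esub> y = y \<otimes>\<^bsub>subgroup_generated G H\<^esub> x"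
      by simp
  qed
qed

section \<open>Left translations and displacements of a quandle\<close>

context quandle
begin

abbreviation perms :: "('a \<Rightarrow> 'a) monoid" (\<open>\<P>\<close>)
  where "\<P> \<equiv> perm_group (carrier Q)"

text \<open>The identity outside the carrier makes the translation a member of
  \<open>perm_group\<close>, whose elements fix every point outside the set.\<close>

definition ltrans :: "'a \<Rightarrow> 'a \<Rightarrow> 'a"
  where "ltrans x = (\<lambda>y. if y \<in> carrier Q then x \<star> y else y)"

lemma ltrans_apply [simp]: "y \<in> carrier Q \<Longrightarrow> ltrans x y = x \<star> y"
  by (simp add: ltrans_def)

lemma ltrans_in_perms [simp]: "ltrans x \<in> carrier \<P>" if x: "x \<in> carrier Q"
  unfolding in_perm_group_iff
proof (rule bij_imp_permutes)
  show "bij_betw (ltrans x) (carrier Q) (carrier Q)"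
    unfolding bij_betw_def
  proof
    show "inj_on (ltrans x) (carrier Q)"
    proof (rule inj_onI)
      fix a b assume ab: "a \<in> carrier Q" "b \<in> carrier Q" "ltrans x a = ltrans x b"
      then have "left_div Q x (x \<star> b) = a" "left_div Q x (x \<star> b) = b"
        using x by (auto intro!: left_div_unique)
      then show "a = b" by simp
    qed
    show "ltrans x ` carrier Q = carrier Q"
    proof (intro equalityI subsetI)
      fix y assume y: "y \<in> carrier Q"
      have "y = ltrans x (left_div Q x y)"
        using x y by (simp add: left_div_closed mult_left_div)
      then show "y \<in> ltrans x ` carrier Q"
        using left_div_closed[OF x y] by (rule image_eqI)
    qed (use x in auto)
  qed
qed (simp add: ltrans_def)

lemma ltrans_pow_apply: "x \<in> carrier Q \<Longrightarrow> y \<in> carrier Q \<Longrightarrow>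
  (ltrans x [^]\<^bsub>\<P>\<^esub> (k::nat)) y = ((\<lambda>u. x \<star> u) ^^ k) y"
  by (induction k arbitrary: y) (simp_all add: perm_group_apply funpow_Suc_right del: funpow.simps(2))

definition displacements :: "('a \<Rightarrow> 'a) set"
  where "displacements = {ltrans x \<otimes>\<^bsub>\<P>\<^esub> inv\<^bsub>\<P>\<^esub> ltrans y | x y. x \<in> carrier Q \<and> y \<in> carrier Q}"

definition Dis :: "('a \<Rightarrow> 'a) monoid"
  where "Dis = subgroup_generated \<P> displacements"

interpretation P: group \<P> by (rule group_perm_group)

lemma mult_Dis [simp]: "p \<otimes>\<^bsub>Dis\<^esub> q = p \<otimes>\<^bsub>\<P>\<^esub> q" and one_Dis [simp]: "\<one>\<^bsub>Dis\<^esub> = \<one>\<^bsub>\<P>\<^esub>"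
  by (simp_all add: Dis_def)

lemma displacements_subset: "displacements \<subseteq> carrier \<P>"
proof
  fix p assume "p \<in> displacements"
  then obtain x y where p: "p = ltrans x \<otimes>\<^bsub>\<P>\<^esub> inv\<^bsub>\<P>\<^esub> ltrans y" and "x \<in> carrier Q" "y \<in> carrier Q"
    unfolding displacements_def by blast
  then show "p \<in> carrier \<P>" by simp
qed

lemma carrier_Dis: "carrier Dis = generate \<P> displacements"
  using displacements_subset by (simp add: Dis_def carrier_subgroup_generated Int_absorb1)

lemma Dis_subset: "p \<in> carrier Dis \<Longrightarrow> p \<in> carrier \<P>"
  using P.generate_incl[OF displacements_subset] by (auto simp: carrier_Dis)

lemma inv_Dis [simp]: "p \<in> carrier Dis \<Longrightarrow> inv\<^bsub>Dis\<^esub> p = inv\<^bsub>\<P>\<^esub> p"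
  unfolding Dis_def by (rule P.inv_subgroup_generated)

lemma displacement_in_Dis:
  "x \<in> carrier Q \<Longrightarrow> y \<in> carrier Q \<Longrightarrow> ltrans x \<otimes>\<^bsub>\<P>\<^esub> inv\<^bsub>\<P>\<^esub> ltrans y \<in> carrier Dis"
  unfolding carrier_Dis displacements_def by (intro generate.incl) blast

lemma Dis_apply_closed: "p \<in> carrier Dis \<Longrightarrow> x \<in> carrier Q \<Longrightarrow> p x \<in> carrier Q"
  using Dis_subset[of p] by (blast intro: perm_group_apply_closed)

text \<open>Inverses need no case of their own: inverting a displacement only exchanges
  \<open>x\<close> and \<open>y\<close>.\<close>

lemma Dis_induct [consumes 1, case_names one displacement mult]:
  assumes "p \<in> carrier Dis"
    and one: "R \<one>\<^bsub>\<P>\<^esub>"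
    and gen: "\<And>x y. x \<in> carrier Q \<Longrightarrow> y \<in> carrier Q \<Longrightarrow> R (ltrans x \<otimes>\<^bsub>\<P>\<^esub> inv\<^bsub>\<P>\<^esub> ltrans y)"
    and mult: "\<And>p q. p \<in> carrier Dis \<Longrightarrow> q \<in> carrier Dis \<Longrightarrow> R p \<Longrightarrow> R q \<Longrightarrow> R (p \<otimes>\<^bsub>\<P>\<^esub> q)"
  shows "R p"
  using assms(1) unfolding carrier_Dis
proof induction
  case one then show ?case by (rule assms(2))
next
  case (incl h)
  then show ?case using gen by (auto simp: displacements_def)
next
  case (inv h)
  then obtain x y where "h = ltrans x \<otimes>\<^bsub>\<P>\<^esub> inv\<^bsub>\<P>\<^esub> ltrans y" and xy: "x \<in> carrier Q" "y \<in> carrier Q"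
    unfolding displacements_def by blast
  then have "inv\<^bsub>\<P>\<^esub> h = ltrans y \<otimes>\<^bsub>\<P>\<^esub> inv\<^bsub>\<P>\<^esub> ltrans x"
    using xy by (simp add: P.inv_mult_group)
  then show ?case using gen xy by simp
next
  case (eng p q)
  then show ?case using mult by (simp add: carrier_Dis)
qed

text \<open>Left distributivity says that \<open>ltrans (x \<star> y)\<close> after
  \<open>ltrans x\<close> equals \<open>ltrans x\<close> after \<open>ltrans y\<close>.\<close>

lemma ltrans_mult_conj:
  assumes "x \<in> carrier Q" "y \<in> carrier Q"
  shows "ltrans (x \<star> y) = ltrans x \<otimes>\<^bsub>\<P>\<^esub> ltrans y \<otimes>\<^bsub>\<P>\<^esub> inv\<^bsub>\<P>\<^esub> ltrans x"
proof -
  have "ltrans (x \<star> y) \<otimes>\<^bsub>\<P>\<^esub> ltrans x = ltrans x \<otimes>\<^bsub>\<P>\<^esub> ltrans y"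
  proof
    fix w
    show "(ltrans (x \<star> y) \<otimes>\<^bsub>\<P>\<^esub> ltrans x) w = (ltrans x \<otimes>\<^bsub>\<P>\<^esub> ltrans y) w"
      using assms left_distrib[of x y w] by (cases "w \<in> carrier Q") (simp_all add: perm_group_apply ltrans_def)
  qed
  then show ?thesis
    using assms by (intro P.inv_solve_right[THEN iffD2]) auto
qed

text \<open>Left translations respect \<open>\<star>\<close> by left distributivity. For the inverse
  of \<open>ltrans v\<close> the equation is checked after applying \<open>ltrans v\<close>.\<close>

lemma Dis_automorphism:
  assumes "p \<in> carrier Dis" "x \<in> carrier Q" "y \<in> carrier Q"
  shows "p (x \<star> y) = p x \<star> p y"
  using assms
proof (induction arbitrary: x y rule: Dis_induct)
  case (displacement u v)
  let ?w = "inv\<^bsub>\<P>\<^esub> ltrans v"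
  have v: "ltrans v \<in> carrier \<P>" using displacement by simp
  have w: "?w a \<in> carrier Q" if "a \<in> carrier Q" for a
    by (rule perm_group_apply_closed[OF P.inv_closed[OF v] that])
  have vw: "v \<star> ?w a = a" if "a \<in> carrier Q" for a
    using perm_group_inv_apply(2)[OF v, of a] w[OF that] by simp
  have "v \<star> (?w x \<star> ?w y) = x \<star> y"
    using displacement w vw left_distrib[of v "?w x" "?w y"] by simp
  then have "?w (x \<star> y) = ?w (v \<star> (?w x \<star> ?w y))" by simp
  also have "\<dots> = ?w x \<star> ?w y"
    using perm_group_inv_apply(1)[OF v, of "?w x \<star> ?w y"] w displacement by simp
  finally show ?case
    using displacement w left_distrib[of u "?w x" "?w y"] by (simp add: perm_group_apply)
next
  case (mult p q)
  then show ?case by (simp add: perm_group_apply Dis_apply_closed)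
qed (simp add: perm_group_apply)

text \<open>An automorphism carries the translation by \<open>x\<close> to the translation by its
  image, so \<open>p\<close> conjugates one to the other.\<close>

lemma ltrans_Dis_apply:
  assumes p: "p \<in> carrier Dis" and x: "x \<in> carrier Q"
  shows "ltrans (p x) = p \<otimes>\<^bsub>\<P>\<^esub> ltrans x \<otimes>\<^bsub>\<P>\<^esub> inv\<^bsub>\<P>\<^esub> p"
proof -
  have pP: "p \<in> carrier \<P>" using p by (rule Dis_subset)
  have "ltrans (p x) \<otimes>\<^bsub>\<P>\<^esub> p = p \<otimes>\<^bsub>\<P>\<^esub> ltrans x"
  proof
    fix w
    show "(ltrans (p x) \<otimes>\<^bsub>\<P>\<^esub> p) w = (p \<otimes>\<^bsub>\<P>\<^esub> ltrans x) w"
      using Dis_automorphism[OF p x, of w] pP Dis_apply_closed[OF p, of w]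
      by (cases "w \<in> carrier Q") (simp_all add: perm_group_apply ltrans_def perm_group_apply_outside)
  qed
  then show ?thesis
    using pP x Dis_apply_closed[OF p x] by (intro P.inv_solve_right[THEN iffD2]) auto
qed

end

section \<open>Displacements in the n-symmetric medial case\<close>

context nsym_medial_quandle
begin

interpretation P: group \<P> by (rule group_perm_group)

text \<open>Mediality equates \<open>ltrans (x \<star> y)\<close> after \<open>ltrans u\<close> with
  \<open>ltrans (x \<star> u)\<close> after \<open>ltrans y\<close>. Writing the translations by
  products as conjugates and cancelling \<open>ltrans x\<close> on the left leaves the
  claim.\<close>

lemma ltrans_medial:
  assumes "x \<in> carrier Q" "y \<in> carrier Q" "u \<in> carrier Q"
  shows "ltrans y \<otimes>\<^bsub>\<P>\<^esub> inv\<^bsub>\<P>\<^esub> ltrans x \<otimes>\<^bsub>\<P>\<^esub> ltrans u = ltrans u \<otimes>\<^bsub>\<P>\<^esub> inv\<^bsub>\<P>\<^esub> ltrans x \<otimes>\<^bsub>\<P>\<^esub> ltrans y"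
proof -
  note T = ltrans_in_perms[OF assms(1)] ltrans_in_perms[OF assms(2)] ltrans_in_perms[OF assms(3)]
  have "ltrans (x \<star> y) \<otimes>\<^bsub>\<P>\<^esub> ltrans u = ltrans (x \<star> u) \<otimes>\<^bsub>\<P>\<^esub> ltrans y"
  proof
    fix w
    show "(ltrans (x \<star> y) \<otimes>\<^bsub>\<P>\<^esub> ltrans u) w = (ltrans (x \<star> u) \<otimes>\<^bsub>\<P>\<^esub> ltrans y) w"
      using assms medial[of x y u w] by (cases "w \<in> carrier Q") (simp_all add: perm_group_apply ltrans_def)
  qed
  then have "ltrans x \<otimes>\<^bsub>\<P>\<^esub> (ltrans y \<otimes>\<^bsub>\<P>\<^esub> inv\<^bsub>\<P>\<^esub> ltrans x \<otimes>\<^bsub>\<P>\<^esub> ltrans u)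
    = ltrans x \<otimes>\<^bsub>\<P>\<^esub> (ltrans u \<otimes>\<^bsub>\<P>\<^esub> inv\<^bsub>\<P>\<^esub> ltrans x \<otimes>\<^bsub>\<P>\<^esub> ltrans y)"
    using assms T by (simp add: ltrans_mult_conj P.m_assoc)
  then show ?thesis
    using T by simp
qed

lemma comm_group_Dis: "comm_group Dis"
  unfolding Dis_def
proof (rule P.comm_group_subgroup_generated[OF displacements_subset])
  fix p q assume "p \<in> displacements" "q \<in> displacements"
  then obtain x y u v where p: "p = ltrans y \<otimes>\<^bsub>\<P>\<^esub> inv\<^bsub>\<P>\<^esub> ltrans x" and q: "q = ltrans u \<otimes>\<^bsub>\<P>\<^esub> inv\<^bsub>\<P>\<^esub> ltrans v"
    and c: "x \<in> carrier Q" "y \<in> carrier Q" "u \<in> carrier Q" "v \<in> carrier Q"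
    unfolding displacements_def by blast
  note T = c[THEN ltrans_in_perms]
  \<comment> \<open>The inverted form of \<open>ltrans_medial\<close> exchanges the two inverse
    translations, as the lemma itself exchanges \<open>y\<close> and \<open>u\<close>. Together the
    two exchanges turn \<open>p\<close> times \<open>q\<close> into \<open>q\<close> times
    \<open>p\<close>.\<close>
  have inv: "inv\<^bsub>\<P>\<^esub> ltrans x \<otimes>\<^bsub>\<P>\<^esub> (ltrans y \<otimes>\<^bsub>\<P>\<^esub> inv\<^bsub>\<P>\<^esub> ltrans v)
      = inv\<^bsub>\<P>\<^esub> ltrans v \<otimes>\<^bsub>\<P>\<^esub> (ltrans y \<otimes>\<^bsub>\<P>\<^esub> inv\<^bsub>\<P>\<^esub> ltrans x)"
  proof -
    have "inv\<^bsub>\<P>\<^esub> (ltrans v \<otimes>\<^bsub>\<P>\<^esub> inv\<^bsub>\<P>\<^esub> ltrans y \<otimes>\<^bsub>\<P>\<^esub> ltrans x)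
        = inv\<^bsub>\<P>\<^esub> (ltrans x \<otimes>\<^bsub>\<P>\<^esub> inv\<^bsub>\<P>\<^esub> ltrans y \<otimes>\<^bsub>\<P>\<^esub> ltrans v)"
      using ltrans_medial[of y v x] c by simp
    then show ?thesis
      using T by (simp add: P.inv_mult_group P.m_assoc)
  qed
  have "p \<otimes>\<^bsub>\<P>\<^esub> q = (ltrans y \<otimes>\<^bsub>\<P>\<^esub> inv\<^bsub>\<P>\<^esub> ltrans x \<otimes>\<^bsub>\<P>\<^esub> ltrans u) \<otimes>\<^bsub>\<P>\<^esub> inv\<^bsub>\<P>\<^esub> ltrans v"
    unfolding p q using T by (simp add: P.m_assoc)
  also have "\<dots> = (ltrans u \<otimes>\<^bsub>\<P>\<^esub> inv\<^bsub>\<P>\<^esub> ltrans x \<otimes>\<^bsub>\<P>\<^esub> ltrans y) \<otimes>\<^bsub>\<P>\<^esub> inv\<^bsub>\<P>\<^esub> ltrans v"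
    using ltrans_medial[OF c(1,2,3)] by (simp only:)
  also have "\<dots> = ltrans u \<otimes>\<^bsub>\<P>\<^esub> (inv\<^bsub>\<P>\<^esub> ltrans x \<otimes>\<^bsub>\<P>\<^esub> (ltrans y \<otimes>\<^bsub>\<P>\<^esub> inv\<^bsub>\<P>\<^esub> ltrans v))"
    using T by (simp add: P.m_assoc)
  also have "\<dots> = q \<otimes>\<^bsub>\<P>\<^esub> p"
    unfolding inv p q using T by (simp add: P.m_assoc)
  finally show "p \<otimes>\<^bsub>\<P>\<^esub> q = q \<otimes>\<^bsub>\<P>\<^esub> p" .
qed

definition conj_ltrans :: "'a \<Rightarrow> ('a \<Rightarrow> 'a) \<Rightarrow> 'a \<Rightarrow> 'a"
  where "conj_ltrans z p = ltrans z \<otimes>\<^bsub>\<P>\<^esub> p \<otimes>\<^bsub>\<P>\<^esub> inv\<^bsub>\<P>\<^esub> ltrans z"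

text \<open>By left distributivity, conjugation by \<open>ltrans z\<close> sends the displacement of
  \<open>x\<close> and \<open>y\<close> to that of \<open>z \<star> x\<close> and
  \<open>z \<star> y\<close>; so it maps \<open>Dis\<close> into itself.\<close>

lemma comm_group_endo_Dis:
  assumes z: "z \<in> carrier Q"
  shows "comm_group_endo Dis (conj_ltrans z)"
proof -
  interpret D: comm_group Dis by (rule comm_group_Dis)
  note zP = ltrans_in_perms[OF z]
  have conj_mult: "conj_ltrans z (p \<otimes>\<^bsub>\<P>\<^esub> q) = conj_ltrans z p \<otimes>\<^bsub>\<P>\<^esub> conj_ltrans z q"
    if "p \<in> carrier \<P>" "q \<in> carrier \<P>" for p q
  proof -
    have "inv\<^bsub>\<P>\<^esub> ltrans z \<otimes>\<^bsub>\<P>\<^esub> (ltrans z \<otimes>\<^bsub>\<P>\<^esub> (q \<otimes>\<^bsub>\<P>\<^esub> inv\<^bsub>\<P>\<^esub> ltrans z)) = q \<otimes>\<^bsub>\<P>\<^esub> inv\<^bsub>\<P>\<^esub> ltrans z"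
      using that zP by (simp add: P.m_assoc[symmetric])
    then show ?thesis
      using that zP by (simp add: conj_ltrans_def P.m_assoc)
  qed
  have "conj_ltrans z p \<in> carrier Dis" if "p \<in> carrier Dis" for p
    using that
  proof (induction rule: Dis_induct)
    case one
    then show ?case using zP D.one_closed by (simp add: conj_ltrans_def)
  next
    case (displacement x y)
    note T = displacement[THEN ltrans_in_perms]
    have "conj_ltrans z (ltrans x \<otimes>\<^bsub>\<P>\<^esub> inv\<^bsub>\<P>\<^esub> ltrans y) = ltrans (z \<star> x) \<otimes>\<^bsub>\<P>\<^esub> inv\<^bsub>\<P>\<^esub> ltrans (z \<star> y)"
    proof -
      have "ltrans (z \<star> y) = conj_ltrans z (ltrans y)" "ltrans (z \<star> x) = conj_ltrans z (ltrans x)"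
        using z displacement by (simp_all add: ltrans_mult_conj conj_ltrans_def)
      moreover have "inv\<^bsub>\<P>\<^esub> conj_ltrans z (ltrans y) = conj_ltrans z (inv\<^bsub>\<P>\<^esub> ltrans y)"
        using zP T by (simp add: conj_ltrans_def P.inv_mult_group P.m_assoc)
      ultimately show ?thesis using conj_mult T by simp
    qed
    also have "\<dots> \<in> carrier Dis"
      using z displacement by (intro displacement_in_Dis) auto
    finally show ?case .
  next
    case (mult p q)
    then have "p \<in> carrier \<P>" "q \<in> carrier \<P>" by (blast intro: Dis_subset)+
    then show ?case
      using D.m_closed[OF mult(3,4)] conj_mult
      by simp
  qed
  then have "conj_ltrans z \<in> hom Dis Dis"
    using conj_mult by (intro homI) (auto simp: Dis_subset)
  then show ?thesis by unfold_locales
qed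

definition disp :: "'a \<Rightarrow> 'a \<Rightarrow> 'a \<Rightarrow> 'a"
  where "disp z x = ltrans x \<otimes>\<^bsub>\<P>\<^esub> inv\<^bsub>\<P>\<^esub> ltrans z"

lemma disp_closed: "z \<in> carrier Q \<Longrightarrow> x \<in> carrier Q \<Longrightarrow> disp z x \<in> carrier Dis"
  unfolding disp_def by (intro displacement_in_Dis)

lemma disp_self: "z \<in> carrier Q \<Longrightarrow> disp z z = \<one>\<^bsub>Dis\<^esub>"
  unfolding disp_def using ltrans_in_perms[of z] by simp

lemma ltrans_pow_n: "x \<in> carrier Q \<Longrightarrow> ltrans x [^]\<^bsub>\<P>\<^esub> n = \<one>\<^bsub>\<P>\<^esub>"
proof
  fix y assume x: "x \<in> carrier Q"
  then have "ltrans x [^]\<^bsub>\<P>\<^esub> n \<in> carrier \<P>" by (intro P.nat_pow_closed ltrans_in_perms)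
  note out = perm_group_apply_outside[OF this, of y]
  show "(ltrans x [^]\<^bsub>\<P>\<^esub> n) y = \<one>\<^bsub>\<P>\<^esub> y"
    using x out by (cases "y \<in> carrier Q") (simp_all add: perm_group_apply ltrans_pow_apply n_symmetric)
qed

text \<open>A telescoping product: \<open>t^k\<close> conjugates \<open>disp z x\<close> by the k-th
  power of \<open>ltrans z\<close>, so the sum of the first k powers of \<open>t\<close> yields
  \<open>L\<^sub>x^k L\<^sub>z^(-k)\<close>. For k = n both powers are trivial.\<close>

lemma geom_poly_act_disp:
  assumes z: "z \<in> carrier Q" and x: "x \<in> carrier Q"
  shows "comm_group_endo.poly_act Dis (conj_ltrans z) (\<Sum>r<n. [:0, 1:] ^ r) (disp z x) = \<one>\<^bsub>Dis\<^esub>"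
proof -
  interpret D: comm_group_endo Dis "conj_ltrans z" using z by (rule comm_group_endo_Dis)
  note d = disp_closed[OF z x]
  let ?z = "ltrans z" and ?x = "ltrans x"
  note T = ltrans_in_perms[OF z] ltrans_in_perms[OF x]
  have pow: "(conj_ltrans z ^^ k) (disp z x)
      = ?z [^]\<^bsub>\<P>\<^esub> k \<otimes>\<^bsub>\<P>\<^esub> disp z x \<otimes>\<^bsub>\<P>\<^esub> inv\<^bsub>\<P>\<^esub> (?z [^]\<^bsub>\<P>\<^esub> k)" for k :: nat
  proof (induction k)
    case 0
    then show ?case using Dis_subset[OF d] by simp
  next
    case (Suc k)
    have zk: "?z [^]\<^bsub>\<P>\<^esub> Suc k = ?z \<otimes>\<^bsub>\<P>\<^esub> ?z [^]\<^bsub>\<P>\<^esub> k"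
      using T(1) by (rule P.nat_pow_Suc2)
    show ?case
      unfolding zk funpow.simps o_apply Suc
      unfolding conj_ltrans_def
      using Dis_subset[OF d] T(1) by (simp add: P.inv_mult_group P.m_assoc)
  qed
  have "D.poly_act (\<Sum>r<k. [:0, 1:] ^ r) (disp z x)
      = ?x [^]\<^bsub>\<P>\<^esub> k \<otimes>\<^bsub>\<P>\<^esub> inv\<^bsub>\<P>\<^esub> (?z [^]\<^bsub>\<P>\<^esub> k)" for k :: nat
  proof (induction k)
    case 0
    then show ?case by simp
  next
    case (Suc k)
    have c: "?x [^]\<^bsub>\<P>\<^esub> k \<in> carrier \<P>" "?z [^]\<^bsub>\<P>\<^esub> k \<in> carrier \<P>" "disp z x \<in> carrier \<P>"
      using T Dis_subset[OF d] by simp_all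
    have "D.poly_act (\<Sum>r<Suc k. [:0, 1:] ^ r) (disp z x)
      = (?x [^]\<^bsub>\<P>\<^esub> k \<otimes>\<^bsub>\<P>\<^esub> inv\<^bsub>\<P>\<^esub> (?z [^]\<^bsub>\<P>\<^esub> k))
        \<otimes>\<^bsub>\<P>\<^esub> (?z [^]\<^bsub>\<P>\<^esub> k \<otimes>\<^bsub>\<P>\<^esub> disp z x \<otimes>\<^bsub>\<P>\<^esub> inv\<^bsub>\<P>\<^esub> (?z [^]\<^bsub>\<P>\<^esub> k))"
      using d by (simp add: D.poly_act_add D.poly_act_power Suc pow)
    also have "\<dots> = ?x [^]\<^bsub>\<P>\<^esub> k \<otimes>\<^bsub>\<P>\<^esub> (inv\<^bsub>\<P>\<^esub> (?z [^]\<^bsub>\<P>\<^esub> k) \<otimes>\<^bsub>\<P>\<^esub> ?z [^]\<^bsub>\<P>\<^esub> k)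
        \<otimes>\<^bsub>\<P>\<^esub> (disp z x \<otimes>\<^bsub>\<P>\<^esub> inv\<^bsub>\<P>\<^esub> (?z [^]\<^bsub>\<P>\<^esub> k))"
      using c by (simp only: P.m_assoc P.m_closed P.inv_closed)
    also have "\<dots> = ?x [^]\<^bsub>\<P>\<^esub> k \<otimes>\<^bsub>\<P>\<^esub> (disp z x \<otimes>\<^bsub>\<P>\<^esub> inv\<^bsub>\<P>\<^esub> (?z [^]\<^bsub>\<P>\<^esub> k))"
      using c by simp
    also have "\<dots> = ?x [^]\<^bsub>\<P>\<^esub> Suc k \<otimes>\<^bsub>\<P>\<^esub> inv\<^bsub>\<P>\<^esub> (?z [^]\<^bsub>\<P>\<^esub> Suc k)"
      using c T by (simp add: disp_def P.inv_mult_group P.m_assoc)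
    finally show ?case .
  qed
  from this[of n] show ?thesis
    using z x by (simp add: ltrans_pow_n)
qed

text \<open>Left multiplication by \<open>p x\<close> is \<open>ltrans x\<close> conjugated by
  \<open>p\<close>. As \<open>y\<close> is idempotent, the inverse of \<open>ltrans y\<close> fixes
  it and may be inserted before \<open>q\<close>; this brings the operator into \<open>Dis\<close>.
  Inserting \<open>ltrans z\<close> and its inverse then splits it into displacements and a
  conjugate.\<close>

lemma Dis_orbit_mult:
  assumes z: "z \<in> carrier Q" and x: "x \<in> carrier Q" and y: "y \<in> carrier Q"
    and p: "p \<in> carrier Dis" and q: "q \<in> carrier Dis"
  shows "p x \<star> q y = (p \<otimes>\<^bsub>\<P>\<^esub> disp z x \<otimes>\<^bsub>\<P>\<^esub> conj_ltrans z (inv\<^bsub>\<P>\<^esub> p \<otimes>\<^bsub>\<P>\<^esub> q) \<otimes>\<^bsub>\<P>\<^esub> inv\<^bsub>\<P>\<^esub> disp z y) y"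
proof -
  let ?x = "ltrans x" and ?y = "ltrans y" and ?z = "ltrans z"
  note T = ltrans_in_perms[OF x] ltrans_in_perms[OF y] ltrans_in_perms[OF z] Dis_subset[OF p] Dis_subset[OF q]
  have "?y y = y" using y by (simp add: idem)
  then have "(inv\<^bsub>\<P>\<^esub> ?y) y = y"
    using perm_group_inv_apply(1)[OF ltrans_in_perms[OF y], of y] by simp
  moreover have "p \<otimes>\<^bsub>\<P>\<^esub> disp z x \<otimes>\<^bsub>\<P>\<^esub> conj_ltrans z (inv\<^bsub>\<P>\<^esub> p \<otimes>\<^bsub>\<P>\<^esub> q) \<otimes>\<^bsub>\<P>\<^esub> inv\<^bsub>\<P>\<^esub> disp z y
      = ltrans (p x) \<otimes>\<^bsub>\<P>\<^esub> q \<otimes>\<^bsub>\<P>\<^esub> inv\<^bsub>\<P>\<^esub> ?y"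
  proof -
    have *: "inv\<^bsub>\<P>\<^esub> ?z \<otimes>\<^bsub>\<P>\<^esub> (?z \<otimes>\<^bsub>\<P>\<^esub> u) = u" if "u \<in> carrier \<P>" for u
      using T that by (simp add: P.m_assoc[symmetric])
    show ?thesis
      unfolding ltrans_Dis_apply[OF p x] using T
      by (simp add: disp_def conj_ltrans_def P.inv_mult_group P.m_assoc *)
  qed
  ultimately show ?thesis
    using Dis_apply_closed[OF q y] by (simp add: perm_group_apply)
qed

lemma left_div_eq_funpow:
  assumes "n > 0" "x \<in> carrier Q" "y \<in> carrier Q"
  shows "left_div Q x y = ((\<lambda>u. x \<star> u) ^^ (n - 1)) y"
proof (rule left_div_unique)
  show "((\<lambda>u. x \<star> u) ^^ k) y \<in> carrier Q" for k
    using assms by (induction k) auto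
  show "x \<star> ((\<lambda>u. x \<star> u) ^^ (n - 1)) y = y"
    using n_symmetric[OF assms(2,3)] assms(1) by (cases n) simp_all
qed fact

section \<open>Polynomial vectors acting through the displacements of the generators\<close>

context
  fixes Xs :: "'x set" and z :: 'x and \<iota> :: "'x \<Rightarrow> 'a"
  assumes z: "z \<in> Xs" and \<iota>: "\<iota> \<in> Xs \<rightarrow> carrier Q"
begin

interpretation D: comm_group_endo Dis "conj_ltrans (\<iota> z)"
  using z \<iota> by (intro comm_group_endo_Dis) auto

text \<open>This is \<phi> of the outline, taken before reduction modulo \<sigma>. The index
  \<open>z\<close> is left out because its displacement is trivial.\<close>

definition Dis_comb :: "('x \<Rightarrow> int poly) \<Rightarrow> 'a \<Rightarrow> 'a"
  where "Dis_comb = D.lincomb (Xs - {z}) (\<lambda>i. disp (\<iota> z) (\<iota> i))"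

abbreviation finsupp :: "('x \<Rightarrow> int poly) \<Rightarrow> bool"
  where "finsupp m \<equiv> finite {i \<in> Xs - {z}. m i \<noteq> 0}"

lemma disp_gen_closed: "i \<in> Xs \<Longrightarrow> disp (\<iota> z) (\<iota> i) \<in> carrier Dis"
  using z \<iota> by (intro disp_closed) auto

lemma disp_gen_funcset: "(\<lambda>i. disp (\<iota> z) (\<iota> i)) \<in> Xs - {z} \<rightarrow> carrier Dis"
  using disp_gen_closed by auto

lemma Dis_comb_closed: "Dis_comb m \<in> carrier Dis"
  unfolding Dis_comb_def using disp_gen_funcset by (rule D.lincomb_closed)

lemma Dis_comb_zero: "Dis_comb (\<lambda>i. 0) = \<one>\<^bsub>\<P>\<^esub>"
  unfolding Dis_comb_def using D.lincomb_zero[OF disp_gen_funcset] by simp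

lemma Dis_comb_add: "finsupp m \<Longrightarrow> finsupp m' \<Longrightarrow>
  Dis_comb (\<lambda>i. m i + m' i) = Dis_comb m \<otimes>\<^bsub>\<P>\<^esub> Dis_comb m'"
  unfolding Dis_comb_def using D.lincomb_add[OF disp_gen_funcset] by simp

lemma Dis_comb_shift:
  "finsupp m \<Longrightarrow> Dis_comb (\<lambda>i. [:0, 1:] * m i) = conj_ltrans (\<iota> z) (Dis_comb m)"
  unfolding Dis_comb_def by (rule D.lincomb_shift[OF disp_gen_funcset])

text \<open>The case \<open>i = z\<close> is included: the indicator of \<open>z\<close> vanishes on
  \<open>Xs - {z}\<close>, in agreement with \<open>e_z = 0\<close>, and \<open>disp\<close> is
  trivial there.\<close>

lemma Dis_comb_unit:
  assumes "i \<in> Xs"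
  shows "Dis_comb (\<lambda>k. if k = i then 1 else 0) = disp (\<iota> z) (\<iota> i)"
proof (cases "i = z")
  case True
  then have "{k \<in> Xs - {z}. (if k = i then 1 else 0) \<noteq> (0 :: int poly)} = {}" by auto
  then have "Dis_comb (\<lambda>k. if k = i then 1 else 0) = \<one>\<^bsub>Dis\<^esub>"
    unfolding Dis_comb_def D.lincomb_def by (simp only: D.finprod_empty)
  moreover have "\<iota> z \<in> carrier Q" using z \<iota> by auto
  ultimately show ?thesis using True by (simp add: disp_self)
next
  case False
  then show ?thesis
    unfolding Dis_comb_def using assms by (subst D.lincomb_unit[OF disp_gen_funcset]) auto
qed

lemma Dis_comb_cong:
  assumes "finsupp m" "finsupp m'"
    and "\<And>i. i \<in> Xs - {z} \<Longrightarrow> (\<Sum>r<n. [:0, 1:] ^ r) dvd m i - m' i"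
  shows "Dis_comb m = Dis_comb m'"
  unfolding Dis_comb_def
proof (rule D.lincomb_eq_if_dvd_diff[OF disp_gen_funcset])
  show "D.poly_act (\<Sum>r<n. [:0, 1:] ^ r) (disp (\<iota> z) (\<iota> i)) = \<one>\<^bsub>Dis\<^esub>" if "i \<in> Xs - {z}" for i
    using that z \<iota> by (intro geom_poly_act_disp) auto
qed (use assms in auto)

text \<open>\<open>M\<close> is the operator of \<open>Dis_orbit_mult\<close> written additively,
  \<open>m + e_i + t (m' - m) - e_l\<close>.\<close>

lemma Dis_comb_mult:
  assumes i: "i \<in> Xs" and l: "l \<in> Xs" and m: "finsupp m" and m': "finsupp m'"
  defines "M \<equiv> \<lambda>k. (if k = i then 1 else 0) - (if k = l then 1 else 0)
    + (1 - [:0, 1:]) * m k + [:0, 1:] * m' k"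
  shows "Dis_comb m (\<iota> i) \<star> Dis_comb m' (\<iota> l) = Dis_comb M (\<iota> l)" and "finsupp M"
proof -
  let ?c = "conj_ltrans (\<iota> z)" and ?p = "Dis_comb m" and ?q = "Dis_comb m'"
  let ?e = "\<lambda>i k. if k = i then 1 else (0 :: int poly)"
  let ?d = "\<lambda>i. disp (\<iota> z) (\<iota> i)"
  have fin_e: "finsupp (?e i)" for i
    by (rule finite_subset[of _ "{i}"]) auto
  have fin_add: "finsupp (\<lambda>k. a k + b k)" if "finsupp a" "finsupp b" for a b
    by (rule finite_subset[OF _ finite_UnI[OF that]]) auto
  have fin_mult: "finsupp (\<lambda>k. r * a k)" if "finsupp a" for r a
    by (rule finite_subset[OF _ that]) auto
  show M: "finsupp M"
    using fin_add[OF fin_add[OF fin_add[OF fin_e[of i] fin_mult[OF fin_e[of l], of "-1"]]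
        fin_mult[OF m, of "1 - [:0, 1:]"]] fin_mult[OF m', of "[:0, 1:]"]]
    unfolding M_def by simp
  \<comment> \<open>Moving the negative terms to the other side gives
    \<open>M + e_l + t m = m + e_i + t m'\<close>, to which additivity and the shift rule apply
    without any rule for differences.\<close>
  have "Dis_comb (\<lambda>k. (M k + ?e l k) + [:0, 1:] * m k) = Dis_comb M \<otimes>\<^bsub>\<P>\<^esub> ?d l \<otimes>\<^bsub>\<P>\<^esub> ?c ?p"
    using M m l fin_e fin_add fin_mult
    by (simp only: Dis_comb_add Dis_comb_shift Dis_comb_unit)
  moreover have "Dis_comb (\<lambda>k. (m k + ?e i k) + [:0, 1:] * m' k) = ?p \<otimes>\<^bsub>\<P>\<^esub> ?d i \<otimes>\<^bsub>\<P>\<^esub> ?c ?q"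
    using m m' i fin_e fin_add fin_mult
    by (simp only: Dis_comb_add Dis_comb_shift Dis_comb_unit)
  moreover have "(M k + ?e l k) + [:0, 1:] * m k = (m k + ?e i k) + [:0, 1:] * m' k" for k
    by (simp add: M_def left_diff_distrib)
  ultimately have *: "Dis_comb M \<otimes>\<^bsub>Dis\<^esub> ?d l \<otimes>\<^bsub>Dis\<^esub> ?c ?p = ?p \<otimes>\<^bsub>Dis\<^esub> ?d i \<otimes>\<^bsub>Dis\<^esub> ?c ?q"
    by simp
  note cl = Dis_comb_closed disp_gen_closed[OF i] disp_gen_closed[OF l] D.endo_closed
  have "?c (inv\<^bsub>\<P>\<^esub> ?p \<otimes>\<^bsub>\<P>\<^esub> ?q) = inv\<^bsub>Dis\<^esub> ?c ?p \<otimes>\<^bsub>Dis\<^esub> ?c ?q"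
  proof -
    have "?c ?p \<otimes>\<^bsub>Dis\<^esub> ?c (inv\<^bsub>Dis\<^esub> ?p \<otimes>\<^bsub>Dis\<^esub> ?q) = ?c (?p \<otimes>\<^bsub>Dis\<^esub> (inv\<^bsub>Dis\<^esub> ?p \<otimes>\<^bsub>Dis\<^esub> ?q))"
      using cl by (intro D.endo_mult[symmetric]) (simp_all only: D.m_closed D.inv_closed)
    also have "?p \<otimes>\<^bsub>Dis\<^esub> (inv\<^bsub>Dis\<^esub> ?p \<otimes>\<^bsub>Dis\<^esub> ?q) = ?q"
      using cl by (simp only: D.m_assoc[symmetric] D.inv_closed D.r_inv D.l_one)
    finally have "?c (inv\<^bsub>Dis\<^esub> ?p \<otimes>\<^bsub>Dis\<^esub> ?q) = inv\<^bsub>Dis\<^esub> ?c ?p \<otimes>\<^bsub>Dis\<^esub> ?c ?q"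
      using cl by (intro D.inv_solve_left[THEN iffD2]) (simp_all only: D.m_closed D.inv_closed)
    then show ?thesis using cl by simp
  qed
  then have "?p \<otimes>\<^bsub>\<P>\<^esub> ?d i \<otimes>\<^bsub>\<P>\<^esub> ?c (inv\<^bsub>\<P>\<^esub> ?p \<otimes>\<^bsub>\<P>\<^esub> ?q) \<otimes>\<^bsub>\<P>\<^esub> inv\<^bsub>\<P>\<^esub> ?d l
      = ?p \<otimes>\<^bsub>Dis\<^esub> ?d i \<otimes>\<^bsub>Dis\<^esub> (inv\<^bsub>Dis\<^esub> ?c ?p \<otimes>\<^bsub>Dis\<^esub> ?c ?q) \<otimes>\<^bsub>Dis\<^esub> inv\<^bsub>Dis\<^esub> ?d l"
    using cl by simp
  also have "\<dots> = (?p \<otimes>\<^bsub>Dis\<^esub> ?d i \<otimes>\<^bsub>Dis\<^esub> ?c ?q) \<otimes>\<^bsub>Dis\<^esub> (inv\<^bsub>Dis\<^esub> ?c ?p \<otimes>\<^bsub>Dis\<^esub> inv\<^bsub>Dis\<^esub> ?d l)"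
    using cl by (simp only: D.m_ac D.m_closed D.inv_closed)
  also have "\<dots> = Dis_comb M \<otimes>\<^bsub>Dis\<^esub> (?d l \<otimes>\<^bsub>Dis\<^esub> inv\<^bsub>Dis\<^esub> ?d l) \<otimes>\<^bsub>Dis\<^esub> (?c ?p \<otimes>\<^bsub>Dis\<^esub> inv\<^bsub>Dis\<^esub> ?c ?p)"
    unfolding *[symmetric] using cl by (simp only: D.m_ac D.m_closed D.inv_closed)
  also have "\<dots> = Dis_comb M"
    using cl by (simp only: D.r_inv D.r_one)
  finally show "?p (\<iota> i) \<star> ?q (\<iota> l) = Dis_comb M (\<iota> l)"
    using Dis_orbit_mult[of "\<iota> z" "\<iota> i" "\<iota> l" ?p ?q] z \<iota> i l Dis_comb_closed by auto
qed

end

end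


section \<open>Tuples of cosets\<close>

definition coset_tuple :: "'j set \<Rightarrow> ('j \<Rightarrow> int poly) \<Rightarrow> 'i set \<Rightarrow> ('i \<Rightarrow> int poly) \<Rightarrow> 'j \<Rightarrow> 'i \<Rightarrow> int poly set"
  where "coset_tuple J f I m = (\<lambda>j\<in>J. \<lambda>i\<in>I. coset (f j) (m i))"

lemma coset_tuple_mult:
  "coset_tuple J f I a \<star>\<^bsub>quandle_prod J (\<lambda>j. affine_component I (f j))\<^esub> coset_tuple J f I b
    = coset_tuple J f I (\<lambda>i. (1 - [:0, 1:]) * a i + [:0, 1:] * b i)"
proof -
  have "(\<one>\<^bsub>Zt_mod g\<^esub> \<ominus>\<^bsub>Zt_mod g\<^esub> t_mod g) \<otimes>\<^bsub>Zt_mod g\<^esub> coset g p \<oplus>\<^bsub>Zt_mod g\<^esub> t_mod g \<otimes>\<^bsub>Zt_mod g\<^esub> coset g q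
      = coset g ((1 - [:0, 1:]) * p + [:0, 1:] * q)" for g p q
    by (simp only: t_mod_def coset_one coset_minus coset_mult coset_add)
  then show ?thesis
    by (simp add: coset_tuple_def affine_component_def cong: restrict_cong)
qed

lemma coset_tuple_eqD:
  assumes "coset_tuple J f I a = coset_tuple J f I b" "j \<in> J" "i \<in> I"
  shows "f j dvd a i - b i"
proof -
  have "coset_tuple J f I a j i = coset_tuple J f I b j i" using assms(1) by simp
  then show ?thesis using assms(2,3) by (simp add: coset_tuple_def coset_eq_iff)
qed

text \<open>No case distinction at \<open>z\<close> is left on the right: \<open>z\<close> is not an
  index, so its indicator is already the zero vector.\<close>

lemma unit_or_zero_eq_coset_tuple:
  "(\<lambda>j\<in>J. unit_or_zero (Xs - {z}) z (f j) i)
    = coset_tuple J f (Xs - {z}) (\<lambda>k. if k = i then 1 else 0)"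
  unfolding coset_tuple_def
  by (intro restrict_ext)
     (auto simp: unit_or_zero_def free_module_def coset_zero coset_one restrict_def fun_eq_iff)

lemma coset_tuple_finite_closed:
  assumes "finite {i \<in> I. m i \<noteq> 0}"
  shows "coset_tuple J f I m \<in> carrier (quandle_prod J (\<lambda>j. affine_component I (f j)))"
proof -
  have "finite {i \<in> I. coset (f j) (m i) \<noteq> coset (f j) 0}" for j
    by (rule finite_subset[OF _ assms]) auto
  then show ?thesis
    by (auto simp: coset_tuple_def affine_component_def coset_zero cong: conj_cong)
qed


section \<open>Free medial quandles\<close>

text \<open>For the homomorphism out of the free quandle this identifies the image with the
  subquandle generated by the images of the generators.\<close>

lemma quandle_hom_span:
  assumes "quandle Q" "h \<in> quandle_hom Q R" "S \<subseteq> carrier Q"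
  shows "h ` quandle_span Q S = quandle_span R (h ` S)"
proof (intro equalityI subsetI)
  have sub: "quandle_span Q S \<subseteq> carrier Q" using assms(1,3) by (rule quandle.quandle_span_subset)
  have hom: "h (x \<star>\<^bsub>Q\<^esub> y) = h x \<star>\<^bsub>R\<^esub> h y" "h (left_div Q x y) = left_div R (h x) (h y)"
    if "x \<in> quandle_span Q S" "y \<in> quandle_span Q S" for x y
    using assms(2) sub that by (auto simp: quandle_hom_def)
  {
    fix b assume "b \<in> h ` quandle_span Q S"
    then obtain a where "a \<in> quandle_span Q S" "b = h a" by auto
    then have "h a \<in> quandle_span R (h ` S)"
      by (induction arbitrary: b) (auto simp: hom intro: quandle_span.intros)
    then show "b \<in> quandle_span R (h ` S)" using \<open>b = h a\<close> by simp
  next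
    fix b assume "b \<in> quandle_span R (h ` S)"
    then show "b \<in> h ` quandle_span Q S"
    proof induction
      case (mult x y)
      then obtain u v where "x = h u" "y = h v" "u \<in> quandle_span Q S" "v \<in> quandle_span Q S" by auto
      then show ?case by (intro image_eqI[of _ _ "u \<star>\<^bsub>Q\<^esub> v"]) (auto simp: hom intro: quandle_span.mult)
    next
      case (ldiv x y)
      then obtain u v where "x = h u" "y = h v" "u \<in> quandle_span Q S" "v \<in> quandle_span Q S" by auto
      then show ?case by (intro image_eqI[of _ _ "left_div Q u v"]) (auto simp: hom intro: quandle_span.ldiv)
    qed (auto intro: quandle_span.base)
  }
qed

theorem theorem4p8:
  fixes Xs :: "'x set" and z :: 'x and n :: nat
    and J :: "'j set" and f :: "'j \<Rightarrow> int poly"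
    and F :: "'a quandle_struct" and \<iota> :: "'x \<Rightarrow> 'a"
  assumes "z \<in> Xs"
    and "n \<noteq> 1"
    and "finite J"
    and "(\<Sum>r<n. [:0, 1:] ^ r) = (\<Prod>j\<in>J. f j)"
    and "\<And>j. j \<in> J \<Longrightarrow> Factorial_Ring.irreducible (f j)"
    and "free_nsym_medial_quandle n Xs F \<iota>"
  shows "quandle_iso F
    (subquandle_generated
      (quandle_prod J (\<lambda>j. affine_component (Xs - {z}) (f j)))
      ((\<lambda>i. \<lambda>j\<in>J. unit_or_zero (Xs - {z}) z (f j) i) ` Xs))"
proof -
  let ?t = "[:0, 1:] :: int poly"
  let ?P = "quandle_prod J (\<lambda>j. affine_component (Xs - {z}) (f j))"
  let ?e = "\<lambda>i. \<lambda>j\<in>J. unit_or_zero (Xs - {z}) z (f j) i"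
  let ?u = "\<lambda>i k. if k = i then 1 else (0 :: int poly)"
  let ?T = "coset_tuple J f (Xs - {z})"
  \<comment> \<open>For n = 0 the sum is empty, but a product of irreducible polynomials is not
    zero.\<close>
  have "n > 0"
  proof (rule ccontr)
    assume "\<not> n > 0"
    then have "(\<Prod>j\<in>J. f j) = 0" using assms(4) by simp
    then obtain j where "j \<in> J" "f j = 0" using assms(3) by auto
    then show False using assms(5)[of j] by (simp add: irreducible_def)
  qed
  \<comment> \<open>For n = 1 the factorization is empty and the product is a single point, whereas
    every set with \<open>x \<star> y = y\<close> is a 1-symmetric medial quandle. Injectivity below
    depends on \<open>\<sigma>(1) = n\<close> not being a unit.\<close>
  then have "n > 1" using assms(2) by simp
  interpret F: nsym_medial_quandle n F
    using assms(6) by (simp add: free_nsym_medial_quandle_def)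
  have \<iota>: "\<iota> \<in> Xs \<rightarrow> carrier F" and span: "quandle_span F (\<iota> ` Xs) = carrier F"
    using assms(6) by (auto simp: free_nsym_medial_quandle_def)
  have "f j dvd geom_poly n" if "j \<in> J" for j
    unfolding assms(4) using assms(3) that by (rule dvd_prodI)
  then have "nsym_medial_quandle n ?P"
    using \<open>n > 0\<close> by (intro nsym_medial_quandle_prod nsym_medial_quandle_affine_component)
  then interpret P: nsym_medial_quandle n ?P .
  have e: "?e i = ?T (?u i)" for i
    by (rule unit_or_zero_eq_coset_tuple)
  have "finite {k \<in> Xs - {z}. ?u i k \<noteq> 0}" for i
    by (rule finite_subset[of _ "{i}"]) auto
  then have e_closed: "?e \<in> Xs \<rightarrow> carrier ?P"
    unfolding e by (blast intro: coset_tuple_finite_closed)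
  obtain h where h: "h \<in> quandle_hom F ?P" and h_gen: "\<And>i. i \<in> Xs \<Longrightarrow> h (\<iota> i) = ?e i"
    using free_universal[OF assms(6) P.nsym_medial_quandle_axioms e_closed] by blast
  have h_mult: "h (a \<star>\<^bsub>F\<^esub> b) = h a \<star>\<^bsub>?P\<^esub> h b" if "a \<in> carrier F" "b \<in> carrier F" for a b
    using h that by (auto simp: quandle_hom_def)

  let ?C = "F.Dis_comb Xs z \<iota>"
  \<comment> \<open>The normal form of \<open>a\<close> and the matching form of its image are
    recorded together, so that one induction over the generated quandle yields both.\<close>
  define rep where "rep a i m \<longleftrightarrow> i \<in> Xs \<and> finite {k \<in> Xs - {z}. m k \<noteq> 0} \<and>
    a = ?C m (\<iota> i) \<and> h a = ?T (\<lambda>k. ?u i k + (1 - ?t) * m k)" for a i m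
  note dis = assms(1) \<iota>
  have rep_closed: "a \<in> carrier F" if "rep a i m" for a i m
    using that F.Dis_apply_closed[OF F.Dis_comb_closed[OF dis]] \<iota> unfolding rep_def by auto
  have rep_h: "h a = ?T (\<lambda>k. ?u i k + (1 - ?t) * m k)" if "rep a i m" for a i m
    using that unfolding rep_def by blast
  \<comment> \<open>A product lies in the orbit of its right factor, so the index \<open>l\<close>
    is kept. The vector \<open>?M\<close> is the one from \<open>Dis_comb_mult\<close>, and an
    affine product in the image gives the same vector.\<close>
  have rep_mult: "\<exists>m. rep (a \<star>\<^bsub>F\<^esub> b) l m" if a: "rep a i m" and b: "rep b l m'" for a b i l m m'
  proof
    let ?M = "\<lambda>k. ?u i k - ?u l k + (1 - ?t) * m k + ?t * m' k"
    have "h (a \<star>\<^bsub>F\<^esub> b) = ?T (\<lambda>k. (1 - ?t) * (?u i k + (1 - ?t) * m k) + ?t * (?u l k + (1 - ?t) * m' k))"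
      unfolding h_mult[OF rep_closed[OF a] rep_closed[OF b]] rep_h[OF a] rep_h[OF b]
      by (rule coset_tuple_mult)
    also have "(\<lambda>k. (1 - ?t) * (?u i k + (1 - ?t) * m k) + ?t * (?u l k + (1 - ?t) * m' k))
        = (\<lambda>k. ?u l k + (1 - ?t) * ?M k)"
    proof -
      have "(1 - t) * (x + (1 - t) * p) + t * (y + (1 - t) * q)
          = y + (1 - t) * (x - y + (1 - t) * p + t * q)" for t x y p q :: "int poly"
        by (simp add: algebra_simps)
      then show ?thesis by blast
    qed
    finally show "rep (a \<star>\<^bsub>F\<^esub> b) l ?M"
      using a b F.Dis_comb_mult[OF dis, of i l m m'] by (simp add: rep_def)
  qed
  have rep_ex: "\<exists>i m. rep a i m" if "a \<in> carrier F" for a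
  proof -
    from that have "a \<in> quandle_span F (\<iota> ` Xs)" by (simp only: span)
    then show ?thesis
    proof induction
      case (base a)
      then obtain i where "i \<in> Xs" "a = \<iota> i" by auto
      then have "rep a i (\<lambda>k. 0)"
        using F.Dis_comb_zero[OF dis] h_gen e by (simp add: rep_def perm_group_apply)
      then show ?case by blast
    next
      case (mult a b)
      then show ?case using rep_mult by blast
    next
      case (ldiv a b)
      then obtain i m l m' where a: "rep a i m" and b: "rep b l m'" by blast
      \<comment> \<open>By n-symmetry a left division is an iterated left multiplication, and each
        multiplication by \<open>a\<close> keeps the index \<open>l\<close>.\<close>
      have "\<exists>m. rep (((\<lambda>u. a \<star>\<^bsub>F\<^esub> u) ^^ k) b) l m" for k
        by (induction k) (use b rep_mult[OF a] in auto)
      then show ?case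
        unfolding F.left_div_eq_funpow[OF \<open>n > 0\<close> rep_closed[OF a] rep_closed[OF b]] by blast
    qed
  qed
  have inj: "inj_on h (carrier F)"
  proof (rule inj_onI)
    fix a b assume ab: "a \<in> carrier F" "b \<in> carrier F" "h a = h b"
    obtain i m where a: "rep a i m" using rep_ex ab(1) by blast
    obtain l m' where b: "rep b l m'" using rep_ex ab(2) by blast
    \<comment> \<open>Equal images agree modulo every \<open>f j\<close>, hence modulo
      \<sigma>.\<close>
    have dvd: "geom_poly n dvd (?u i k + (1 - ?t) * m k) - (?u l k + (1 - ?t) * m' k)"
      if "k \<in> Xs - {z}" for k
    proof (rule geom_poly_dvd_if_irreducible_factors_dvd[OF \<open>n > 0\<close> assms(3-5)])
      show "f j dvd (?u i k + (1 - ?t) * m k) - (?u l k + (1 - ?t) * m' k)" if "j \<in> J" for j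
        using ab(3) that \<open>k \<in> Xs - {z}\<close> unfolding rep_h[OF a] rep_h[OF b] by (rule coset_tuple_eqD)
    qed
    \<comment> \<open>Distinct indices cannot both be \<open>z\<close>. In a coordinate other than
      \<open>z\<close> where one of them sits, the difference is 1 or -1 plus a multiple of
      \<open>1 - t\<close>, which \<sigma> does not divide.\<close>
    have "i = l"
    proof (rule ccontr)
      assume "i \<noteq> l"
      then consider "i \<in> Xs - {z}" | "l \<in> Xs - {z}" using a b by (auto simp: rep_def)
      then show False
      proof cases
        case 1
        have "(1 + (1 - ?t) * m i) - (0 + (1 - ?t) * m' i) = [:1:] + (1 - ?t) * (m i - m' i)"
          by (simp add: algebra_simps)
        then show False
          using dvd[OF 1] \<open>i \<noteq> l\<close> geom_poly_not_dvd[OF \<open>n > 1\<close>, of 1] by simp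
      next
        case 2
        have "(0 + (1 - ?t) * m l) - (1 + (1 - ?t) * m' l) = [:-1:] + (1 - ?t) * (m l - m' l)"
          by (simp add: algebra_simps) (simp add: one_pCons)
        then show False
          using dvd[OF 2] \<open>i \<noteq> l\<close> geom_poly_not_dvd[OF \<open>n > 1\<close>, of "-1"] by simp
      qed
    qed
    \<comment> \<open>With equal indices the unit vectors cancel, and the factor
      \<open>1 - t\<close> of the remaining difference can be removed because \<sigma> does not
      vanish at 1.\<close>
    moreover have "?C m = ?C m'"
    proof (rule F.Dis_comb_cong[OF dis])
      fix k assume "k \<in> Xs - {z}"
      then have "geom_poly n dvd (1 - ?t) * (m k - m' k)"
        using dvd[of k] \<open>i = l\<close> by (simp add: right_diff_distrib)
      with \<open>n > 0\<close> show "geom_poly n dvd m k - m' k" by (rule geom_poly_dvd_cancel)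
    qed (use a b in \<open>auto simp: rep_def\<close>)
    ultimately show "a = b" using a b by (simp add: rep_def)
  qed
  let ?S = "subquandle_generated ?P (?e ` Xs)"
  have "?e ` Xs \<subseteq> carrier ?P" using e_closed by blast
  then interpret S: nsym_medial_quandle n ?S
    by (rule P.nsym_medial_quandle_generated)
  have "h ` \<iota> ` Xs = ?e ` Xs"
    unfolding image_image using h_gen by (rule image_cong[OF refl])
  then have img: "h ` carrier F = carrier ?S"
    using quandle_hom_span[OF F.quandle_axioms h, of "\<iota> ` Xs"] \<iota>
    by (auto simp: span subquandle_generated_def)
  \<comment> \<open>Left division in \<open>?S\<close> is defined by a search in the smaller
    carrier, so its preservation is derived anew from that of \<open>\<star>\<close>.\<close>
  have "h \<in> quandle_hom F ?S"
  proof (rule F.quandle_homI)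
    show "quandle ?S" by unfold_locales
    show "h \<in> carrier F \<rightarrow> carrier ?S" using img by auto
    show "h (x \<star>\<^bsub>F\<^esub> y) = h x \<star>\<^bsub>?S\<^esub> h y" if "x \<in> carrier F" "y \<in> carrier F" for x y
      using h_mult[OF that] by (simp add: subquandle_generated_def)
  qed
  moreover have "bij_betw h (carrier F) (carrier ?S)"
    using inj img by (simp add: bij_betw_def)
  ultimately show ?thesis unfolding quandle_iso_def by blast
qed

end
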